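(* Let $n\ge1$ and $\phi\in\mathcal{B}_n$. Consider the following nine conditions: - (a1) $t_1^\phi=t_1$; (a2) $t_1^\phi\in(t_1{\star})\setminus\{t_1\}$; (a3) $t_1^\phi\notin(t_1{\star})$; - (b1) $\phi$ is $\sigma_1$-neutral; (b2) $\phi$ is $\sigma_1$-negative; (b3) $\phi$ is $\sigma_1$-positive; - (c1) $(t_1{\star})^\phi=(t_1{\star})$; (c2) $(t_1{\star})^\phi\subsetneq(t_1{\star})$; (c3) $(t_1{\star})^\phi\supsetneq(t_1{\star})$. Then (a1)$\Leftrightarrow$(b1)$\Leftrightarrow$(c1), (a2)$\Leftrightarrow$(b2)$\Leftrightarrow$(c2), and (a3)$\Leftrightarrow$(b3)$\Leftrightarrow$(c3). Moreover, exactly one of (b1), (b2), (b3) holds.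
   Context: $\Sigma_{0,1,n}$ is the free group with free basis $t_1,\dots,t_n$, and $z_1:=(t_1\cdots t_n)^{-1}$. Notation: $\overline a:=a^{-1}$, $a^b:=b^{-1}ab$. Automorphisms act on the right and are written as exponents; they compose left to right. $\mathcal{B}_n$ is the group of all automorphisms $\phi$ of $\Sigma_{0,1,n}$ such that $z_1^\phi=z_1$ and $\phi$ permutes the set of conjugacy classes $\{[t_1],\dots,[t_n]\}$. For $i\in\{1,\dots,n-1\}$, $\sigma_i$ is given by $t_k^{\sigma_i}=t_k$ for $k\notin\{i,i+1\}$, $t_i^{\sigma_i}=t_{i+1}$, and $t_{i+1}^{\sigma_i}=\overline t_{i+1}t_it_{i+1}$. $(w{\star})$ denotes the set of elements whose reduced word in $t_1^{\pm1},\dots,t_n^{\pm1}$ begins with the reduced word of $w$, and $(t_1{\star})^\phi=\{x^\phi: x\in(t_1{\star})\}$. The following notions are used: - $\phi$ is $\sigma_1$-neutral if $\phi$ lies in the subgroup generated by $\sigma_2,\dots,\sigma_{n-1}$. - $\phi$ is $\sigma_1$-positive if $n\ge2$ and $\phi$ is a product of a finite sequence of elements of $\{\sigma_1,\dots,\sigma_{n-1}\}\cup\{\sigma_2^{-1},\dots,\sigma_{n-1}^{-1}\}$ in which $\sigma_1$ occurs at least once. - $\phi$ is $\sigma_1$-negative if $\phi^{-1}$ is $\sigma_1$-positive. *)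

theory Defs
  imports "HOL-Library.Sublist" "HOL-Library.FuncSet"
begin

text \<open>A letter (i, False) stands for t_i, a letter (i, True) for t_i^{-1}.
  Generators are indexed 1..n as in the paper.\<close>

type_synonym letter = "nat \<times> bool"
type_synonym word = "letter list"

definition flip :: "letter \<Rightarrow> letter" where
  "flip a = (fst a, \<not> snd a)"

fun reduced :: "word \<Rightarrow> bool" where
  "reduced [] = True"
| "reduced [a] = True"
| "reduced (a # b # w) = (b \<noteq> flip a \<and> reduced (b # w))"

definition red_cons :: "letter \<Rightarrow> word \<Rightarrow> word" where
  "red_cons a w = (case w of [] \<Rightarrow> [a] | b # w' \<Rightarrow> (if b = flip a then w' else a # w))"

definition reduce :: "word \<Rightarrow> word" where
  "reduce ws = foldr red_cons ws []"

definition F :: "nat \<Rightarrow> word set" where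
  "F n = {w. reduced w \<and> (\<forall>a\<in>set w. 1 \<le> fst a \<and> fst a \<le> n)}"

definition fmul :: "word \<Rightarrow> word \<Rightarrow> word" where
  "fmul u v = reduce (u @ v)"

definition finv :: "word \<Rightarrow> word" where
  "finv w = rev (map flip w)"

definition gen :: "nat \<Rightarrow> word" where
  "gen i = [(i, False)]"

definition z1 :: "nat \<Rightarrow> word" where
  "z1 n = finv (map (\<lambda>i. (i, False)) [1..<Suc n])"

definition conjugate :: "nat \<Rightarrow> word \<Rightarrow> word \<Rightarrow> bool" where
  "conjugate n u v = (\<exists>g\<in>F n. v = fmul (finv g) (fmul u g))"

definition conj_class :: "nat \<Rightarrow> word \<Rightarrow> word set" where
  "conj_class n u = {v \<in> F n. conjugate n u v}"

section \<open>Automorphisms (acting on the right, composed left to right)\<close>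

definition is_aut :: "nat \<Rightarrow> (word \<Rightarrow> word) \<Rightarrow> bool" where
  "is_aut n \<phi> = (\<phi> \<in> extensional (F n) \<and> bij_betw \<phi> (F n) (F n) \<and>
     (\<forall>u\<in>F n. \<forall>v\<in>F n. \<phi> (fmul u v) = fmul (\<phi> u) (\<phi> v)))"

definition comp_aut :: "nat \<Rightarrow> (word \<Rightarrow> word) \<Rightarrow> (word \<Rightarrow> word) \<Rightarrow> (word \<Rightarrow> word)" where
  "comp_aut n \<phi> \<psi> = (\<lambda>x\<in>F n. \<psi> (\<phi> x))"

definition id_aut :: "nat \<Rightarrow> word \<Rightarrow> word" where
  "id_aut n = (\<lambda>x\<in>F n. x)"

definition inv_aut :: "nat \<Rightarrow> (word \<Rightarrow> word) \<Rightarrow> (word \<Rightarrow> word)" where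
  "inv_aut n \<phi> = (\<lambda>x\<in>F n. inv_into (F n) \<phi> x)"

definition ext_hom :: "nat \<Rightarrow> (nat \<Rightarrow> word) \<Rightarrow> (word \<Rightarrow> word)" where
  "ext_hom n f = (\<lambda>w\<in>F n. reduce (concat (map (\<lambda>a. if snd a then finv (f (fst a)) else f (fst a)) w)))"

definition B :: "nat \<Rightarrow> (word \<Rightarrow> word) set" where
  "B n = {\<phi>. is_aut n \<phi> \<and> \<phi> (z1 n) = z1 n \<and>
     bij_betw (\<lambda>C. \<phi> ` C) ((\<lambda>i. conj_class n (gen i)) ` {1..n})
                           ((\<lambda>i. conj_class n (gen i)) ` {1..n})}"

definition sigma :: "nat \<Rightarrow> nat \<Rightarrow> (word \<Rightarrow> word)" where
  "sigma n i = ext_hom n (\<lambda>k. if k = i then gen (Suc i)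
       else if k = Suc i then fmul (finv (gen (Suc i))) (fmul (gen i) (gen (Suc i)))
       else gen k)"

fun aut_prod :: "nat \<Rightarrow> (nat \<times> bool) list \<Rightarrow> (word \<Rightarrow> word)" where
  "aut_prod n [] = id_aut n"
| "aut_prod n (a # as) =
     comp_aut n (if snd a then inv_aut n (sigma n (fst a)) else sigma n (fst a)) (aut_prod n as)"

definition sigma1_neutral :: "nat \<Rightarrow> (word \<Rightarrow> word) \<Rightarrow> bool" where
  "sigma1_neutral n \<phi> =
     (\<exists>ws. (\<forall>a\<in>set ws. 2 \<le> fst a \<and> fst a \<le> n - 1) \<and> \<phi> = aut_prod n ws)"

definition sigma1_positive :: "nat \<Rightarrow> (word \<Rightarrow> word) \<Rightarrow> bool" where
  "sigma1_positive n \<phi> = (2 \<le> n \<and>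
     (\<exists>ws. (\<forall>a\<in>set ws. 1 \<le> fst a \<and> fst a \<le> n - 1 \<and> (snd a \<longrightarrow> 2 \<le> fst a))
          \<and> (1, False) \<in> set ws \<and> \<phi> = aut_prod n ws))"

definition sigma1_negative :: "nat \<Rightarrow> (word \<Rightarrow> word) \<Rightarrow> bool" where
  "sigma1_negative n \<phi> = sigma1_positive n (inv_aut n \<phi>)"

definition star :: "nat \<Rightarrow> word \<Rightarrow> word set" where
  "star n w = {x \<in> F n. prefix w x}"

end

theory Submission
  imports Defs
begin

text \<open>Put \<open>g\<^sub>i = t\<^sub>i\<^sup>\<phi>\<close>. Each \<open>g\<^sub>i\<close> has reduced form \<open>P\<^sub>i c\<^sub>i P\<^sub>i\<^sup>-\<^sup>1\<close> with a generator \<open>c\<^sub>i\<close>, and \<open>g\<^sub>1 \<cdots> g\<^sub>n = t\<^sub>1 \<cdots> t\<^sub>n\<close>.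
  If \<open>P\<^sub>i\<^sub>+\<^sub>1\<close> starts with \<open>P\<^sub>i c\<^sub>i\<^sup>-\<^sup>1\<close>, then \<open>\<phi> = \<sigma>\<^sub>i \<phi>'\<close> with \<open>\<phi>'\<close> shorter; if \<open>P\<^sub>i\<close> starts with
  \<open>P\<^sub>i\<^sub>+\<^sub>1 c\<^sub>i\<^sub>+\<^sub>1\<close>, then \<open>\<phi> = \<sigma>\<^sub>i\<^sup>-\<^sup>1 \<phi>'\<close> with \<open>\<phi>'\<close> shorter (Artin). When \<open>g\<^sub>1\<close> starts with \<open>t\<^sub>1\<close> and no such
  step with \<open>i \<ge> 2\<close> is possible, counting the letters \<open>t\<^sub>1\<^sup>\<plusminus>\<^sup>1\<close> shows that \<open>\<phi>\<close> is trivial or that \<open>\<sigma>\<^sub>1\<^sup>-\<^sup>1\<close> can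
  be split off; hence \<open>\<phi>\<close> is neutral or negative. When \<open>g\<^sub>1\<close> does not start with \<open>t\<^sub>1\<close>, conjugation by
  the mirror involution \<open>t\<^sub>k \<mapsto> (t\<^sub>1 \<cdots> t\<^sub>k\<^sub>-\<^sub>1) t\<^sub>k\<^sup>-\<^sup>1 (t\<^sub>1 \<cdots> t\<^sub>k\<^sub>-\<^sub>1)\<^sup>-\<^sup>1\<close>, which inverts every \<open>\<sigma>\<^sub>i\<close>,
  reduces to the first case. Conversely \<open>\<sigma>\<^sub>1\<^sup>-\<^sup>1\<close> maps \<open>(t\<^sub>1\<star>)\<close> into \<open>(t\<^sub>1t\<^sub>2\<star>)\<close> and \<open>\<sigma>\<^sub>i\<^sup>\<plusminus>\<^sup>1\<close>, \<open>i \<ge> 2\<close>, fix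
  \<open>(t\<^sub>1\<star>)\<close>, so the conditions on \<open>t\<^sub>1\<^sup>\<phi>\<close> and \<open>(t\<^sub>1\<star>)\<^sup>\<phi>\<close> can be read off from a braid word.\<close>

section \<open>Reduced words\<close>

lemma flip_flip [simp]: "flip (flip a) = a"
  by (simp add: flip_def)

lemma fst_flip [simp]: "fst (flip a) = fst a"
  by (simp add: flip_def)

lemma flip_Pair [simp]: "flip (i, b) = (i, \<not> b)"
  by (simp add: flip_def)

lemma flip_neq [simp]: "flip a \<noteq> a" "a \<noteq> flip a"
  by (cases a; simp)+

lemma flip_eq_iff [simp]: "flip a = flip b \<longleftrightarrow> a = b"
  by (metis flip_flip)

lemma finv_Nil [simp]: "finv [] = []"
  by (simp add: finv_def)

lemma finv_Cons [simp]: "finv (a # w) = finv w @ [flip a]"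
  by (simp add: finv_def)

lemma finv_append [simp]: "finv (u @ v) = finv v @ finv u"
  by (simp add: finv_def)

lemma finv_finv [simp]: "finv (finv w) = w"
  by (induction w) auto

lemma length_finv [simp]: "length (finv w) = length w"
  by (simp add: finv_def)

lemma finv_eq_Nil [simp]: "finv w = [] \<longleftrightarrow> w = []"
  by (simp add: finv_def)

lemma reduced_append:
  "reduced (u @ v) \<longleftrightarrow> reduced u \<and> reduced v \<and> (u \<noteq> [] \<longrightarrow> v \<noteq> [] \<longrightarrow> hd v \<noteq> flip (last u))"
proof (induction u rule: reduced.induct)
  case (2 a)
  then show ?case by (cases v) auto
qed auto

lemma reduced_Cons: "reduced (a # w) \<longleftrightarrow> reduced w \<and> (w \<noteq> [] \<longrightarrow> hd w \<noteq> flip a)"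
  by (cases w) auto

lemma reduced_finv [simp]: "reduced (finv w) \<longleftrightarrow> reduced w"
proof -
  have "reduced w \<Longrightarrow> reduced (finv w)" for w
  proof (induction w rule: reduced.induct)
    case (3 a b w)
    then show ?case by (auto simp: reduced_append)
  qed auto
  from this[of w] this[of "finv w"] show ?thesis by auto
qed

section \<open>Letters acting on reduced words, and free reduction\<close>

lemma red_cons_Nil [simp]: "red_cons a [] = [a]"
  by (simp add: red_cons_def)

lemma red_cons_Cons: "red_cons a (b # w) = (if b = flip a then w else a # b # w)"
  by (simp add: red_cons_def)

lemma reduced_red_cons: "reduced w \<Longrightarrow> reduced (red_cons a w)"
  by (cases w) (auto simp: red_cons_Cons reduced_Cons)

text \<open>Each letter acts on reduced words as a permutation with inverse the action of
  \<open>flip a\<close>. All group laws are derived from this action, so no confluence argument is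
  required.\<close>

lemma red_cons_flip: "reduced w \<Longrightarrow> red_cons a (red_cons (flip a) w) = w"
  by (cases w rule: reduced.cases) (auto simp: red_cons_Cons)

lemma set_red_cons: "set (red_cons a w) \<subseteq> insert a (set w)"
  by (cases w) (auto simp: red_cons_Cons)

lemma length_red_cons: "length (red_cons a w) \<le> Suc (length w)"
  by (cases w) (auto simp: red_cons_Cons)

lemma reduce_Nil [simp]: "reduce [] = []"
  by (simp add: reduce_def)

lemma reduce_Cons: "reduce (a # w) = red_cons a (reduce w)"
  by (simp add: reduce_def)

lemma reduced_reduce [simp]: "reduced (reduce w)"
  by (induction w) (auto simp: reduce_Cons reduced_red_cons)

lemma reduce_reduced [simp]: "reduced w \<Longrightarrow> reduce w = w"
  by (induction w rule: reduced.induct) (auto simp: reduce_Cons red_cons_Cons)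

lemma set_reduce: "set (reduce w) \<subseteq> set w"
proof (induction w)
  case (Cons a w)
  then show ?case using set_red_cons[of a "reduce w"] by (auto simp: reduce_Cons)
qed simp

lemma length_reduce: "length (reduce w) \<le> length w"
proof (induction w)
  case (Cons a w)
  then show ?case using length_red_cons[of a "reduce w"] by (simp add: reduce_Cons)
qed simp

lemma reduce_append: "reduce (u @ v) = foldr red_cons u (reduce v)"
  by (simp add: reduce_def)

lemma reduce_append_reduce_right [simp]: "reduce (u @ reduce v) = reduce (u @ v)"
  by (simp add: reduce_append)

lemma reduced_foldr: "reduced x \<Longrightarrow> reduced (foldr red_cons u x)"
  by (induction u) (auto simp: reduced_red_cons)

text \<open>If \<open>a\<close> cancels the first letter of \<open>w\<close>, the two actions cancel
  as well by \<open>red_cons_flip\<close>; hence a word and its reduction act alike.\<close>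

lemma foldr_red_cons: "reduced x \<Longrightarrow> foldr red_cons (red_cons a w) x = red_cons a (foldr red_cons w x)"
  by (cases w) (auto simp: red_cons_Cons red_cons_flip reduced_foldr)

lemma foldr_reduce: "reduced x \<Longrightarrow> foldr red_cons (reduce u) x = foldr red_cons u x"
  by (induction u) (auto simp: reduce_Cons foldr_red_cons)

lemma reduce_append_reduce_left [simp]: "reduce (reduce u @ v) = reduce (u @ v)"
  by (simp add: reduce_append foldr_reduce)

text \<open>Words with equal \<open>reduce\<close> represent the same group element. This
  compatibility with concatenation allows rewriting inside unreduced products.\<close>

lemma reduce_append_cong:
  "reduce u = reduce u' \<Longrightarrow> reduce v = reduce v' \<Longrightarrow> reduce (u @ v) = reduce (u' @ v')"
  by (metis reduce_append_reduce_left reduce_append_reduce_right)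

lemma reduce_cancel [simp]:
  "reduce (a # flip a # w) = reduce w" "reduce (flip a # a # w) = reduce w"
  using red_cons_flip[of "reduce w" a] red_cons_flip[of "reduce w" "flip a"] by (simp_all add: reduce_Cons)

lemma reduce_append_cancel [simp]:
  "reduce (u @ a # flip a # w) = reduce (u @ w)" "reduce (u @ flip a # a # w) = reduce (u @ w)"
  by (rule reduce_append_cong; simp)+

lemma reduce_finv_cancel [simp]:
  "reduce (u @ finv u @ w) = reduce w" "reduce (finv u @ u @ w) = reduce w"
proof (induction u arbitrary: w)
  case (Cons a u)
  {
    case 1
    have "reduce ((a # u) @ finv (a # u) @ w) = red_cons a (reduce (u @ finv u @ flip a # w))"
      by (simp add: reduce_Cons)
    also have "\<dots> = reduce (a # flip a # w)"
      by (simp only: Cons.IH reduce_Cons)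
    finally show ?case by simp
  next
    case 2
    then show ?case by (simp add: Cons.IH)
  }
qed simp_all

lemma reduce_append_finv_cancel [simp]:
  "reduce (v @ u @ finv u @ w) = reduce (v @ w)" "reduce (v @ finv u @ u @ w) = reduce (v @ w)"
  by (rule reduce_append_cong; simp)+

lemma reduce_finv_self [simp]:
  "reduce (u @ finv u) = []" "reduce (finv u @ u) = []"
  using reduce_finv_cancel[of u "[]"] by simp_all

lemma reduce_finv_red_cons: "reduce (finv (red_cons a w)) = reduce (finv w @ [flip a])"
  using reduce_append_cancel(1)[of _ _ "[]"]
  by (cases w) (auto simp: red_cons_Cons)

lemma reduce_finv: "reduce (finv w) = finv (reduce w)"
proof (induction w)
  case (Cons a w)
  have "finv (reduce (a # w)) = reduce (finv (red_cons a (reduce w)))"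
    by (simp add: reduce_Cons reduced_red_cons)
  also have "\<dots> = reduce (finv (reduce w) @ [flip a])"
    by (rule reduce_finv_red_cons)
  also have "\<dots> = reduce (reduce (finv w) @ [flip a])"
    by (simp only: Cons.IH)
  also have "\<dots> = reduce (finv (a # w))" by simp
  finally show ?case by simp
qed simp

lemma reduce_eq_left_cancel: "reduce (u @ v) = reduce (u @ v') \<longleftrightarrow> reduce v = reduce v'"
proof
  assume "reduce (u @ v) = reduce (u @ v')"
  then have "reduce (finv u @ u @ v) = reduce (finv u @ u @ v')"
    by (rule reduce_append_cong[OF refl])
  then show "reduce v = reduce v'" by simp
qed (rule reduce_append_cong[OF refl])

definition words :: "nat \<Rightarrow> word set" where
  "words n = {w. \<forall>a\<in>set w. 1 \<le> fst a \<and> fst a \<le> n}"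

lemma words_simps [simp]:
  "[] \<in> words n"
  "a # w \<in> words n \<longleftrightarrow> 1 \<le> fst a \<and> fst a \<le> n \<and> w \<in> words n"
  "u @ v \<in> words n \<longleftrightarrow> u \<in> words n \<and> v \<in> words n"
  "finv w \<in> words n \<longleftrightarrow> w \<in> words n"
  by (auto simp: words_def finv_def)

lemma F_iff: "w \<in> F n \<longleftrightarrow> reduced w \<and> w \<in> words n"
  by (auto simp: F_def words_def)

lemma reduce_words: "w \<in> words n \<Longrightarrow> reduce w \<in> words n"
  using set_reduce[of w] by (auto simp: words_def)

lemma reduce_in_F [simp]: "w \<in> words n \<Longrightarrow> reduce w \<in> F n"
  by (simp add: F_iff reduce_words)

lemma F_words: "w \<in> F n \<Longrightarrow> w \<in> words n"
  by (simp add: F_iff)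

lemma gen_words [simp]: "gen i \<in> words n \<longleftrightarrow> 1 \<le> i \<and> i \<le> n"
  by (simp add: gen_def)

lemma reduced_gen [simp]: "reduced (gen i)"
  by (simp add: gen_def)

section \<open>Substitutions and homomorphisms\<close>

text \<open>Substitution without reduction commutes with concatenation and \<open>finv\<close> on
  the nose, so homomorphism identities become list equations with a single \<open>reduce\<close>
  outside.\<close>

definition subst :: "(nat \<Rightarrow> word) \<Rightarrow> word \<Rightarrow> word" where
  "subst f w = concat (map (\<lambda>a. if snd a then finv (f (fst a)) else f (fst a)) w)"

lemma subst_simps [simp]:
  "subst f [] = []"
  "subst f (a # w) = (if snd a then finv (f (fst a)) else f (fst a)) @ subst f w"
  "subst f (u @ v) = subst f u @ subst f v"
  by (auto simp: subst_def)

lemma subst_gen [simp]: "subst f (gen i) = f i"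
  by (simp add: gen_def)

lemma subst_finv [simp]: "subst f (finv w) = finv (subst f w)"
  by (induction w) (auto simp: flip_def)

lemma subst_subst: "subst g (subst f w) = subst (\<lambda>i. subst g (f i)) w"
  by (induction w) auto

lemma subst_gen_id [simp]: "subst gen w = w"
  by (induction w) (auto simp: gen_def flip_def)

lemma subst_words:
  assumes "\<And>i. 1 \<le> i \<Longrightarrow> i \<le> n \<Longrightarrow> f i \<in> words n" "w \<in> words n"
  shows "subst f w \<in> words n"
  using assms(2) by (induction w) (auto simp: assms(1))

text \<open>A letter that cancels in \<open>red_cons\<close> cancels against its inverse, and their
  images are a word next to its \<open>finv\<close>.\<close>

lemma reduce_subst [simp]: "reduce (subst f (reduce w)) = reduce (subst f w)"
proof (induction w)
  case (Cons a w)
  have *: "reduce (subst f (red_cons a v)) = reduce (subst f [a] @ subst f v)" for v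
    by (cases v) (auto simp: red_cons_Cons flip_def)
  have "reduce (subst f (reduce (a # w))) = reduce (subst f [a] @ subst f (reduce w))"
    by (simp only: reduce_Cons *)
  also have "\<dots> = reduce (subst f [a] @ subst f w)"
    by (rule reduce_append_cong[OF refl Cons.IH])
  finally show ?case by simp
qed simp

lemma reduce_subst_cong:
  assumes "\<And>i. 1 \<le> i \<Longrightarrow> i \<le> n \<Longrightarrow> reduce (f i) = reduce (g i)" "w \<in> words n"
  shows "reduce (subst f w) = reduce (subst g w)"
  using assms(2)
proof (induction w)
  case (Cons a w)
  have "reduce (subst f [a]) = reduce (subst g [a])"
    using Cons.prems assms(1)[of "fst a"] by (simp add: reduce_finv)
  from reduce_append_cong[OF this Cons.IH] Cons.prems show ?case by simp
qed simp

lemma ext_hom_apply: "w \<in> F n \<Longrightarrow> ext_hom n f w = reduce (subst f w)"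
  by (simp add: ext_hom_def subst_def)

lemma ext_hom_extensional [simp]: "ext_hom n f \<in> extensional (F n)"
  by (simp add: ext_hom_def)

lemma ext_hom_cong:
  assumes "\<And>i. 1 \<le> i \<Longrightarrow> i \<le> n \<Longrightarrow> reduce (f i) = reduce (g i)"
  shows "ext_hom n f = ext_hom n g"
proof (rule extensionalityI[where A = "F n"])
  fix w assume "w \<in> F n"
  with reduce_subst_cong[OF assms, of n] show "ext_hom n f w = ext_hom n g w"
    by (simp add: ext_hom_apply F_words)
qed simp_all

lemma ext_hom_in_F:
  assumes "\<And>i. 1 \<le> i \<Longrightarrow> i \<le> n \<Longrightarrow> f i \<in> words n" "w \<in> F n"
  shows "ext_hom n f w \<in> F n"
  using assms by (simp add: ext_hom_apply subst_words F_words)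

text \<open>The images under \<open>f\<close> have to stay in \<open>words n\<close> because
  \<open>ext_hom n g\<close> is \<open>undefined\<close> outside \<open>F n\<close>.\<close>

lemma comp_ext_hom:
  assumes "\<And>i. 1 \<le> i \<Longrightarrow> i \<le> n \<Longrightarrow> f i \<in> words n"
  shows "comp_aut n (ext_hom n f) (ext_hom n g) = ext_hom n (\<lambda>i. subst g (f i))"
proof (rule extensionalityI[where A = "F n"])
  fix w assume w: "w \<in> F n"
  then show "comp_aut n (ext_hom n f) (ext_hom n g) w = ext_hom n (\<lambda>i. subst g (f i)) w"
    using ext_hom_in_F[OF assms w]
    by (simp add: comp_aut_def ext_hom_apply subst_words[OF assms] F_words subst_subst)
qed (simp_all add: comp_aut_def)

lemma id_aut_ext_hom: "id_aut n = ext_hom n gen"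
  by (rule extensionalityI[where A = "F n"]) (simp_all add: id_aut_def ext_hom_apply F_iff)

lemma comp_aut_extensional [simp]: "comp_aut n f g \<in> extensional (F n)"
  by (simp add: comp_aut_def)

lemma id_aut_extensional [simp]: "id_aut n \<in> extensional (F n)"
  by (simp add: id_aut_def)

lemma comp_aut_assoc:
  assumes "f \<in> F n \<rightarrow> F n"
  shows "comp_aut n (comp_aut n f g) h = comp_aut n f (comp_aut n g h)"
  using assms by (auto simp: comp_aut_def restrict_def fun_eq_iff)

lemma comp_id_left: "f \<in> extensional (F n) \<Longrightarrow> comp_aut n (id_aut n) f = f"
  by (rule extensionalityI[where A = "F n"]) (simp_all add: comp_aut_def id_aut_def)

lemma comp_id_right: "f \<in> F n \<rightarrow> F n \<Longrightarrow> f \<in> extensional (F n) \<Longrightarrow> comp_aut n f (id_aut n) = f"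
  by (rule extensionalityI[where A = "F n"]) (auto simp: comp_aut_def id_aut_def)

lemma comp_aut_funcset: "f \<in> F n \<rightarrow> F n \<Longrightarrow> g \<in> F n \<rightarrow> F n \<Longrightarrow> comp_aut n f g \<in> F n \<rightarrow> F n"
  by (auto simp: comp_aut_def)

lemma inv_aut_unique:
  assumes "f \<in> F n \<rightarrow> F n" "g \<in> F n \<rightarrow> F n" "g \<in> extensional (F n)"
    and "comp_aut n f g = id_aut n" "comp_aut n g f = id_aut n"
  shows "inv_aut n f = g"
proof (rule extensionalityI[where A = "F n"])
  have fg: "g (f w) = w" "f (g w) = w" if "w \<in> F n" for w
    using fun_cong[OF assms(4), of w] fun_cong[OF assms(5), of w] that
    by (simp_all add: comp_aut_def id_aut_def)
  then have inj: "inj_on f (F n)" by (metis inj_onI)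
  fix w assume w: "w \<in> F n"
  with assms(2) have "g w \<in> F n" by auto
  with inv_into_f_f[OF inj this] fg[OF w] w show "inv_aut n f w = g w"
    by (simp add: inv_aut_def)
qed (simp_all add: inv_aut_def assms)

section \<open>Braid words\<close>

text \<open>Braid letters have the type of group letters, with \<open>(i, True)\<close> for the
  inverse of sigma_i, so \<open>flip\<close> and \<open>finv\<close> also invert braid words. The
  inverse is given explicitly and justified by \<open>comp_braid_img_inverse\<close>.\<close>

definition braid_img :: "nat \<times> bool \<Rightarrow> nat \<Rightarrow> word" where
  "braid_img a k = (let i = fst a in
     if snd a then
       if k = i then [(i, False), (Suc i, False), (i, True)]
       else if k = Suc i then [(i, False)] else gen k
     else
       if k = i then [(Suc i, False)]
       else if k = Suc i then [(Suc i, True), (i, False), (Suc i, False)] else gen k)"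

definition braid_words :: "nat \<Rightarrow> (nat \<times> bool) list set" where
  "braid_words n = {ws. \<forall>a\<in>set ws. 1 \<le> fst a \<and> fst a \<le> n - 1}"

lemma braid_words_simps [simp]:
  "[] \<in> braid_words n"
  "a # ws \<in> braid_words n \<longleftrightarrow> 1 \<le> fst a \<and> fst a \<le> n - 1 \<and> ws \<in> braid_words n"
  "us @ ws \<in> braid_words n \<longleftrightarrow> us \<in> braid_words n \<and> ws \<in> braid_words n"
  "finv ws \<in> braid_words n \<longleftrightarrow> ws \<in> braid_words n"
  "map flip ws \<in> braid_words n \<longleftrightarrow> ws \<in> braid_words n"
  by (auto simp: braid_words_def finv_def)

lemma braid_img_words:
  assumes "1 \<le> fst a" "fst a \<le> n - 1" "1 \<le> k" "k \<le> n"
  shows "braid_img a k \<in> words n"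
  using assms by (auto simp: braid_img_def Let_def)

lemma sigma_ext_hom: "sigma n i = ext_hom n (braid_img (i, False))"
  unfolding sigma_def
  by (rule ext_hom_cong)
    (auto simp: braid_img_def Let_def fmul_def gen_def reduce_Cons red_cons_Cons)

lemma comp_braid_img_inverse:
  assumes "1 \<le> fst a" "fst a \<le> n - 1"
  shows "comp_aut n (ext_hom n (braid_img a)) (ext_hom n (braid_img (flip a))) = id_aut n"
proof -
  have "reduce (subst (braid_img (flip a)) (braid_img a k)) = reduce (gen k)" for k
    by (cases a; cases "snd a")
      (auto simp: braid_img_def Let_def gen_def reduce_Cons red_cons_Cons)
  then show ?thesis
    unfolding id_aut_ext_hom
    by (subst comp_ext_hom) (auto intro!: ext_hom_cong braid_img_words assms)
qed

lemma braid_img_funcset: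
  assumes "1 \<le> fst a" "fst a \<le> n - 1"
  shows "ext_hom n (braid_img a) \<in> F n \<rightarrow> F n"
  using ext_hom_in_F[of n "braid_img a"] braid_img_words[OF assms] by blast

lemma inv_aut_sigma:
  assumes "1 \<le> i" "i \<le> n - 1"
  shows "inv_aut n (sigma n i) = ext_hom n (braid_img (i, True))"
  unfolding sigma_ext_hom
  using comp_braid_img_inverse[of "(i, False)" n] comp_braid_img_inverse[of "(i, True)" n] assms
  by (intro inv_aut_unique braid_img_funcset) auto

text \<open>Treats both signs alike by replacing \<open>sigma\<close> and \<open>inv_aut\<close>
  with explicit substitutions; later proofs therefore withhold \<open>aut_prod.simps\<close> from
  the simplifier.\<close>

lemma aut_prod_Cons:
  assumes "1 \<le> fst a" "fst a \<le> n - 1"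
  shows "aut_prod n (a # ws) = comp_aut n (ext_hom n (braid_img a)) (aut_prod n ws)"
  using assms by (cases a) (auto simp: inv_aut_sigma sigma_ext_hom[symmetric])

lemma aut_prod_extensional [simp]: "aut_prod n ws \<in> extensional (F n)"
  by (cases ws) auto

lemma aut_prod_funcset: "ws \<in> braid_words n \<Longrightarrow> aut_prod n ws \<in> F n \<rightarrow> F n"
proof (induction ws)
  case Nil
  then show ?case by (auto simp: id_aut_def)
next
  case (Cons a ws)
  then have "comp_aut n (ext_hom n (braid_img a)) (aut_prod n ws) \<in> F n \<rightarrow> F n"
    by (intro comp_aut_funcset braid_img_funcset) auto
  with Cons.prems show ?case by (simp add: aut_prod_Cons del: aut_prod.simps)
qed

lemma aut_prod_append:
  assumes "us \<in> braid_words n"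
  shows "aut_prod n (us @ ws) = comp_aut n (aut_prod n us) (aut_prod n ws)"
  using assms
proof (induction us)
  case Nil
  then show ?case by (simp add: comp_id_left)
next
  case (Cons a us)
  then show ?case
    by (simp add: aut_prod_Cons comp_aut_assoc braid_img_funcset del: aut_prod.simps)
qed

lemma aut_prod_single:
  assumes "1 \<le> fst a" "fst a \<le> n - 1"
  shows "aut_prod n [a] = ext_hom n (braid_img a)"
  using assms by (simp add: aut_prod_Cons comp_id_right braid_img_funcset del: aut_prod.simps(2))

text \<open>Composition runs left to right, so the product over \<open>ws\<close> followed by
  \<open>finv ws\<close> cancels from the middle outwards.\<close>

lemma comp_aut_prod_inverse:
  assumes "ws \<in> braid_words n"
  shows "comp_aut n (aut_prod n ws) (aut_prod n (finv ws)) = id_aut n"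
  using assms
proof (induction ws)
  case Nil
  then show ?case by (simp add: comp_id_left)
next
  case (Cons a ws)
  let ?e = "\<lambda>a. ext_hom n (braid_img a)"
  from Cons.prems have a: "1 \<le> fst a" "fst a \<le> n - 1" and ws: "ws \<in> braid_words n" by auto
  have "comp_aut n (aut_prod n (a # ws)) (aut_prod n (finv (a # ws)))
      = comp_aut n (?e a) (comp_aut n (aut_prod n ws) (comp_aut n (aut_prod n (finv ws)) (?e (flip a))))"
    using a ws by (simp add: aut_prod_Cons[of a] aut_prod_append aut_prod_single comp_aut_assoc
        braid_img_funcset aut_prod_funcset del: aut_prod.simps)
  also have "\<dots> = comp_aut n (?e a) (comp_aut n (comp_aut n (aut_prod n ws) (aut_prod n (finv ws))) (?e (flip a)))"
    using ws by (simp add: comp_aut_assoc aut_prod_funcset)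
  also have "\<dots> = id_aut n"
    using a ws by (simp add: Cons.IH comp_id_left comp_braid_img_inverse)
  finally show ?case .
qed

lemma inv_aut_prod:
  assumes "ws \<in> braid_words n"
  shows "inv_aut n (aut_prod n ws) = aut_prod n (finv ws)"
  using comp_aut_prod_inverse[of ws n] comp_aut_prod_inverse[of "finv ws" n] assms
  by (intro inv_aut_unique aut_prod_funcset) auto

lemma aut_prod_inverse_apply:
  assumes "ws \<in> braid_words n" "w \<in> F n"
  shows "aut_prod n ws (aut_prod n (finv ws) w) = w"
  using fun_cong[OF comp_aut_prod_inverse[of "finv ws" n], of w] assms
  by (simp add: comp_aut_def id_aut_def)

section \<open>The action of braid words on initial segments\<close>

text \<open>With letters \<open>p\<close>, \<open>q\<close> the map \<open>p \<mapsto> p q p\<^sup>-\<^sup>1\<close>, \<open>q \<mapsto> p\<close> is \<open>\<sigma>\<^sub>i\<^sup>-\<^sup>1\<close> for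
  \<open>p = t\<^sub>i\<close>, \<open>q = t\<^sub>i\<^sub>+\<^sub>1\<close>, and \<open>\<sigma>\<^sub>i\<close> for the inverse letters \<open>p = t\<^sub>i\<^sub>+\<^sub>1\<^sup>-\<^sup>1\<close>, \<open>q = t\<^sub>i\<^sup>-\<^sup>1\<close>.\<close>

lemma half_twist_initial_letters:
  fixes e :: "letter \<Rightarrow> word"
  assumes pq: "fst p \<noteq> fst q"
    and e: "e p = [p, q, flip p]" "e (flip p) = [p, flip q, flip p]" "e q = [p]" "e (flip q) = [flip p]"
      "\<And>a. fst a \<noteq> fst p \<Longrightarrow> fst a \<noteq> fst q \<Longrightarrow> e a = [a]"
    and w: "reduced w"
  defines "v \<equiv> reduce (concat (map e w))"
  shows "(w = [] \<longrightarrow> v = [])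
    \<and> (w \<noteq> [] \<longrightarrow> hd w = p \<longrightarrow> (\<exists>v'. v = p # q # v'))
    \<and> (w \<noteq> [] \<longrightarrow> hd w = flip p \<longrightarrow> (\<exists>v'. v = p # flip q # v'))
    \<and> (w \<noteq> [] \<longrightarrow> hd w = q \<longrightarrow> v = [p] \<or> (\<exists>b v'. v = p # b # v' \<and> fst b \<noteq> fst q))
    \<and> (w \<noteq> [] \<longrightarrow> hd w = flip q \<longrightarrow> (\<exists>b v'. v = b # v' \<and> (b = flip p \<or> fst b = fst q)))
    \<and> (w \<noteq> [] \<longrightarrow> fst (hd w) \<noteq> fst p \<longrightarrow> fst (hd w) \<noteq> fst q \<longrightarrow> (\<exists>v'. v = hd w # v'))"
  using w unfolding v_def
proof (induction w)
  case (Cons a w)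
  have cases: "a = p \<or> a = flip p \<or> a = q \<or> a = flip q \<or> (fst a \<noteq> fst p \<and> fst a \<noteq> fst q)" for a
    by (cases a; cases p; cases q) auto
  have neq: "p \<noteq> q" "p \<noteq> flip q" "q \<noteq> p" "flip q \<noteq> p" "flip p \<noteq> q" "q \<noteq> flip p"
    using pq by auto
  define u where "u = reduce (concat (map e w))"
  have red: "reduce (concat (map e (a # w))) = foldr red_cons (e a) u"
    by (simp add: reduce_append u_def)
  have "reduced u" by (simp add: u_def)
  note IH = Cons.IH[folded u_def]
  from Cons.prems have "reduced w" and hd: "w \<noteq> [] \<Longrightarrow> hd w \<noteq> flip a"
    by (auto simp: reduced_Cons)
  note IH = IH[OF this(1)]
  \<comment> \<open>Multiplying by \<open>e a\<close> can cancel only at the start of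
    \<open>u\<close>, so these shapes decide the outcome. For \<open>hd w = q\<close> the index of
    the second letter is recorded: once \<open>flip p\<close> has cancelled \<open>p\<close>, the
    letter \<open>q\<close> or \<open>flip q\<close> before it must survive.\<close>
  have W: "w = [] \<and> u = []
    \<or> w \<noteq> [] \<and> hd w = p \<and> (\<exists>v'. u = p # q # v')
    \<or> w \<noteq> [] \<and> hd w = flip p \<and> (\<exists>v'. u = p # flip q # v')
    \<or> w \<noteq> [] \<and> hd w = q \<and> u = [p]
    \<or> w \<noteq> [] \<and> hd w = q \<and> (\<exists>b v'. u = p # b # v' \<and> fst b \<noteq> fst q)
    \<or> w \<noteq> [] \<and> hd w = flip q \<and> (\<exists>v'. u = flip p # v')
    \<or> w \<noteq> [] \<and> hd w = flip q \<and> (\<exists>b v'. u = b # v' \<and> fst b = fst q)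
    \<or> w \<noteq> [] \<and> fst (hd w) \<noteq> fst p \<and> fst (hd w) \<noteq> fst q \<and> (\<exists>v'. u = hd w # v')"
  proof (cases "w = []")
    case True
    with IH show ?thesis by simp
  next
    case False
    with IH cases[of "hd w"] show ?thesis by metis
  qed
  have neq': "x \<noteq> y" if "fst x \<noteq> fst y" for x y :: letter using that by auto
  note facts = e red_cons_Cons neq neq' pq pq[symmetric]
  consider "a = p" | "a = flip p" | "a = q" | "a = flip q" | "fst a \<noteq> fst p" "fst a \<noteq> fst q"
    using cases by blast
  then show ?case
  proof cases
    case 1
    from W hd show ?thesis unfolding red
      by (elim disjE exE conjE; simp add: 1 facts)
  next
    case 2
    from W hd show ?thesis unfolding red
      by (elim disjE exE conjE; simp add: 2 facts)
  next
    case 3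
    from W hd show ?thesis unfolding red
      by (elim disjE exE conjE; simp add: 3 facts)
  next
    case 4
    from W hd show ?thesis unfolding red
      by (elim disjE exE conjE; simp add: 4 facts)
  next
    case 5
    from W hd show ?thesis unfolding red
      using 5 by (elim disjE exE conjE; auto simp: e red_cons_Cons)
  qed
qed simp

section \<open>Braid letters and the elements starting with t_1\<close>

lemma star_iff: "w \<in> star n (gen i) \<longleftrightarrow> w \<in> F n \<and> (\<exists>w'. w = (i, False) # w')"
  by (auto simp: star_def gen_def prefix_def)

text \<open>Here p = t_1 and q = t_2: an image starting with t_1 t_2 cannot be t_1 itself.\<close>

lemma sigma1_inverse_star:
  assumes "2 \<le> n" "w \<in> star n (gen 1)"
  shows "ext_hom n (braid_img (1, True)) w \<in> star n (gen 1) - {gen 1}"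
proof -
  let ?e = "\<lambda>a. subst (braid_img (1, True)) [a]"
  from assms obtain w' where w: "w \<in> F n" "w = (1, False) # w'" by (auto simp: star_iff)
  have "\<exists>v'. reduce (concat (map ?e w)) = (1, False) # (2, False) # v'"
    using half_twist_initial_letters[of "(1, False)" "(2, False)" ?e w] w
    by (auto simp: F_iff braid_img_def gen_def Let_def split: if_splits)
  moreover have "concat (map ?e w) = subst (braid_img (1, True)) w" by (simp add: subst_def)
  moreover have "ext_hom n (braid_img (1, True)) w \<in> F n"
    using funcset_mem[OF braid_img_funcset w(1)] assms(1) by simp
  ultimately show ?thesis using w(1) by (auto simp: star_iff ext_hom_apply) (simp add: gen_def)
qed

text \<open>Both letters of the half twist have index at least 2, so an initial t_1 falls under the
  clause of \<open>half_twist_initial_letters\<close> for uninvolved letters and survives.\<close>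

lemma sigma_star:
  assumes "2 \<le> fst a" "fst a \<le> n - 1" "w \<in> star n (gen 1)"
  shows "ext_hom n (braid_img a) w \<in> star n (gen 1)"
proof -
  let ?e = "\<lambda>b. subst (braid_img a) [b]"
  from assms obtain w' where w: "w \<in> F n" "w = (1, False) # w'" by (auto simp: star_iff)
  obtain i b where a: "a = (i, b)" by (cases a)
  have "\<exists>v'. reduce (concat (map ?e w)) = (1, False) # v'"
  proof (cases b)
    case True
    then show ?thesis
      using half_twist_initial_letters[of "(i, False)" "(Suc i, False)" ?e w] w assms(1) a
      by (auto simp: F_iff braid_img_def gen_def Let_def split: if_splits)
  next
    case False
    then show ?thesis
      using half_twist_initial_letters[of "(Suc i, True)" "(i, True)" ?e w] w assms(1) a
      by (auto simp: F_iff braid_img_def gen_def Let_def split: if_splits)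
  qed
  moreover have "concat (map ?e w) = subst (braid_img a) w" by (simp add: subst_def)
  moreover have "ext_hom n (braid_img a) w \<in> F n"
    using braid_img_funcset[of a n] assms w(1) by auto
  ultimately show ?thesis using w(1) by (auto simp: star_iff ext_hom_apply)
qed

lemma sigma_fixes_gen1:
  assumes "2 \<le> fst a" "fst a \<le> n - 1"
  shows "ext_hom n (braid_img a) (gen 1) = gen 1"
proof -
  have "gen 1 \<in> F n" using assms by (simp add: F_iff)
  with assms show ?thesis by (auto simp: ext_hom_apply braid_img_def Let_def)
qed

text \<open>Serves the neutral and the negative case together; they differ in whether
  \<open>(1, True)\<close> occurs.\<close>

definition nonpos_words :: "nat \<Rightarrow> (nat \<times> bool) list set" where
  "nonpos_words n = {ws \<in> braid_words n. (1, False) \<notin> set ws}"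

lemma nonpos_words_simps [simp]:
  "[] \<in> nonpos_words n"
  "a # ws \<in> nonpos_words n \<longleftrightarrow> 1 \<le> fst a \<and> fst a \<le> n - 1 \<and> a \<noteq> (1, False) \<and> ws \<in> nonpos_words n"
  by (auto simp: nonpos_words_def)

text \<open>The inverse of sigma_1 moves every element of the star off t_1. A letter of index at
  least 2 fixes t_1 and is injective, so it sends nothing else to t_1.\<close>

lemma nonpos_letter_star:
  assumes "1 \<le> fst a" "fst a \<le> n - 1" "a \<noteq> (1, False)" "w \<in> star n (gen 1)"
    and "w \<noteq> gen 1 \<or> fst a = 1"
  shows "ext_hom n (braid_img a) w \<in> star n (gen 1) - {gen 1}"
proof (cases "fst a = 1")
  case True
  with assms(3) have "a = (1, True)" by (cases a) auto
  with sigma1_inverse_star[of n w] assms show ?thesis by auto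
next
  case False
  with assms(1) have a: "2 \<le> fst a" by simp
  have "gen 1 \<in> F n" "w \<in> F n" using assms by (simp_all add: F_iff star_iff)
  with comp_braid_img_inverse[OF assms(1,2), THEN fun_cong, of "gen 1"]
    comp_braid_img_inverse[OF assms(1,2), THEN fun_cong, of w] sigma_fixes_gen1[OF a assms(2)]
  have "ext_hom n (braid_img a) w \<noteq> gen 1" if "w \<noteq> gen 1"
    using that by (auto simp: comp_aut_def id_aut_def)
  with sigma_star[OF a assms(2,4)] False assms(5) show ?thesis by auto
qed

text \<open>Starting from t_1, nothing moves until the first inverse of sigma_1; after that letter
  the element differs from t_1 and never returns to it.\<close>

lemma nonpos_word_star:
  assumes "ws \<in> nonpos_words n" "w \<in> star n (gen 1)" "w \<noteq> gen 1 \<or> (1, True) \<in> set ws"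
  shows "aut_prod n ws w \<in> star n (gen 1) - {gen 1}"
  using assms
proof (induction ws arbitrary: w)
  case Nil
  then show ?case by (auto simp: id_aut_def star_iff)
next
  case (Cons a ws)
  let ?v = "ext_hom n (braid_img a) w"
  have a: "1 \<le> fst a" "fst a \<le> n - 1" "a \<noteq> (1, False)" and ws: "ws \<in> nonpos_words n"
    using Cons.prems by auto
  have v: "aut_prod n (a # ws) w = aut_prod n ws ?v"
    using a Cons.prems(2) by (simp add: aut_prod_Cons comp_aut_def star_iff del: aut_prod.simps)
  show ?case
  proof (cases "w \<noteq> gen 1 \<or> fst a = 1")
    case True
    from nonpos_letter_star[OF a Cons.prems(2) this] Cons.IH[OF ws, of ?v] show ?thesis
      unfolding v by blast
  next
    case False
    then have "2 \<le> fst a" "w = gen 1" "a \<noteq> (1, True)" using a(1) by auto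
    with sigma_fixes_gen1[OF this(1) a(2)] have "?v = gen 1" "(1, True) \<in> set ws"
      using Cons.prems(3) by auto
    with Cons.IH[OF ws, of ?v] Cons.prems(2) \<open>w = gen 1\<close> show ?thesis
      unfolding v by simp
  qed
qed

lemma neutral_fixes_gen1:
  assumes "1 \<le> n" "\<forall>a\<in>set ws. 2 \<le> fst a \<and> fst a \<le> n - 1"
  shows "aut_prod n ws (gen 1) = gen 1"
  using assms(2)
proof (induction ws)
  case Nil
  then show ?case using assms(1) by (simp add: id_aut_def F_iff)
next
  case (Cons a ws)
  then have "1 \<le> fst a" "fst a \<le> n - 1" "2 \<le> fst a" by auto
  with Cons assms(1) sigma_fixes_gen1[of a n] show ?case
    by (simp add: aut_prod_Cons comp_aut_def F_iff del: aut_prod.simps)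
qed

lemma neutral_star_subset:
  assumes "1 \<le> n" "\<forall>a\<in>set ws. 2 \<le> fst a \<and> fst a \<le> n - 1"
  shows "aut_prod n ws ` star n (gen 1) \<subseteq> star n (gen 1)"
proof -
  have "ws \<in> nonpos_words n" using assms(2) by (force simp: nonpos_words_def braid_words_def)
  moreover have "gen 1 \<in> star n (gen 1)" using assms(1) by (simp add: star_iff F_iff) (simp add: gen_def)
  ultimately show ?thesis
    using nonpos_word_star[of ws n] neutral_fixes_gen1[OF assms] by fastforce
qed

text \<open>The inverse of a neutral word is neutral, so the inclusion
  \<open>neutral_star_subset\<close> for both gives equality.\<close>

lemma neutral_star:
  assumes "1 \<le> n" "\<forall>a\<in>set ws. 2 \<le> fst a \<and> fst a \<le> n - 1"
  shows "aut_prod n ws ` star n (gen 1) = star n (gen 1)"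
proof
  show "star n (gen 1) \<subseteq> aut_prod n ws ` star n (gen 1)"
  proof
    fix w assume w: "w \<in> star n (gen 1)"
    have "\<forall>a\<in>set (finv ws). 2 \<le> fst a \<and> fst a \<le> n - 1"
      using assms(2) by (auto simp: finv_def)
    from neutral_star_subset[OF assms(1) this] w
    have "aut_prod n (finv ws) w \<in> star n (gen 1)" by blast
    moreover have "aut_prod n ws (aut_prod n (finv ws) w) = w"
    proof (rule aut_prod_inverse_apply)
      show "ws \<in> braid_words n" using assms(2) by (force simp: braid_words_def)
      show "w \<in> F n" using w by (simp add: star_iff)
    qed
    ultimately show "w \<in> aut_prod n ws ` star n (gen 1)" by (metis imageI)
  qed
qed (rule neutral_star_subset[OF assms])

section \<open>Tuples of conjugates with product \<open>t\<^sub>1 \<cdots> t\<^sub>n\<close>\<close>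

abbreviation conj_word :: "word \<Rightarrow> nat \<Rightarrow> word" where
  "conj_word P c \<equiv> P @ (c, False) # finv P"

abbreviation letter_count :: "nat \<Rightarrow> word \<Rightarrow> nat" where
  "letter_count k w \<equiv> length (filter (\<lambda>a. fst a = k) w)"

lemma letter_count_finv [simp]: "letter_count k (finv w) = letter_count k w"
  by (induction w) auto

lemma last_finv: "w \<noteq> [] \<Longrightarrow> last (finv w) = flip (hd w)"
  by (cases w) auto

lemma reduced_appendD: "reduced (u @ v) \<Longrightarrow> reduced u" "reduced (u @ v) \<Longrightarrow> reduced v"
  by (simp_all add: reduced_append)

lemma reduced_positive: "(\<And>a. a \<in> set w \<Longrightarrow> \<not> snd a) \<Longrightarrow> reduced w"
proof (induction w)
  case (Cons a w)
  then have "\<not> snd a" "w \<noteq> [] \<Longrightarrow> \<not> snd (hd w)" by auto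
  then have "w \<noteq> [] \<Longrightarrow> hd w \<noteq> flip a" by (metis flip_def snd_conv)
  with Cons show ?case by (simp add: reduced_Cons)
qed simp

lemma conj_word_normal_form: "\<exists>P. reduce (conj_word u c) = conj_word P c"
proof -
  have "\<exists>P. reduce (conj_word u c) = conj_word P c" if "reduced u" for u
    using that
  proof (induction u rule: rev_induct)
    case (snoc a u)
    show ?case
    proof (cases "fst a = c")
      case True
      then have "a = (c, False) \<or> a = (c, True)" by (cases a) auto
      then have "reduce ([a] @ (c, False) # [flip a]) = [(c, False)]"
        by (auto simp: reduce_Cons red_cons_Cons)
      then have "reduce (([a] @ (c, False) # [flip a]) @ finv u) = reduce ([(c, False)] @ finv u)"
        by (metis reduce_append_reduce_left)
      then have "reduce (u @ ([a] @ (c, False) # [flip a]) @ finv u) = reduce (u @ [(c, False)] @ finv u)"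
        by (rule reduce_append_cong[OF refl])
      with snoc show ?thesis by (simp add: reduced_append)
    next
      case False
      with snoc.prems have "reduced (conj_word (u @ [a]) c)"
        using reduced_finv[of "u @ [a]"]
        by (cases a) (auto simp: reduced_append reduced_Cons last_finv)
      then show ?thesis by (metis reduce_reduced)
    qed
  qed (auto intro: exI[of _ "[]"])
  from this[of "reduce u"] obtain P where "reduce (conj_word (reduce u) c) = conj_word P c" by auto
  moreover have "reduce (conj_word (reduce u) c) = reduce (conj_word u c)"
    by (intro reduce_append_cong) (simp_all add: reduce_Cons reduce_finv)
  ultimately show ?thesis by metis
qed

text \<open>The two excluded prefixes are exactly those under which an elementary braid move
  shortens one of two neighbouring conjugates; see \<open>absorption_step_positive\<close> and
  \<open>absorption_step_negative\<close>.\<close>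

definition no_absorption :: "word \<times> nat \<Rightarrow> word \<times> nat \<Rightarrow> bool" where
  "no_absorption x y \<longleftrightarrow> \<not> prefix (fst x @ [(snd x, True)]) (fst y)
     \<and> \<not> prefix (fst y @ [(snd y, False)]) (fst x)"

text \<open>Induction from the right. Between neighbours only the common prefix of their conjugators
  cancels, and both middle generators survive. The letters of \<open>P\<close> reappear in
  \<open>W\<close>, partly through \<open>finv A\<close> and partly through the count for
  \<open>P'\<close>; these bounds drive \<open>absorption_at_first\<close>.\<close>

lemma tight_product:
  assumes "successively no_absorption ((P, c) # L)"
    and "\<And>x. x \<in> set ((P, c) # L) \<Longrightarrow> reduced (conj_word (fst x) (snd x))"
  shows "\<exists>W. reduce (concat (map (\<lambda>x. conj_word (fst x) (snd x)) ((P, c) # L))) = P @ (c, False) # W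
    \<and> (\<forall>k. letter_count k P \<le> letter_count k W) \<and> length L \<le> length W
    \<and> (length W = length L \<longrightarrow> (\<forall>x\<in>set ((P, c) # L). fst x = []))"
  using assms
proof (induction L arbitrary: P c)
  case Nil
  then show ?case by (intro exI[of _ "finv P"]) auto
next
  case (Cons x L)
  obtain P' c' where x: "x = (P', c')" by (cases x)
  let ?cw = "\<lambda>x. conj_word (fst x) (snd x)"
  from Cons.prems x have na: "no_absorption (P, c) (P', c')"
    and suc: "successively no_absorption ((P', c') # L)" by auto
  have "reduced (?cw y)" if "y \<in> set ((P', c') # L)" for y
    using Cons.prems(2)[of y] that x by simp
  from Cons.IH[OF suc this] obtain W' where
    W': "reduce (concat (map ?cw ((P', c') # L))) = P' @ (c', False) # W'"
      "\<forall>k. letter_count k P' \<le> letter_count k W'" "length L \<le> length W'"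
      "length W' = length L \<longrightarrow> (\<forall>x\<in>set ((P', c') # L). fst x = [])"
    by blast
  obtain M A B where M: "P = M @ A" "P' = M @ B" "A = [] \<or> B = [] \<or> hd A \<noteq> hd B"
    using longest_common_prefix by blast
  define W where "W = finv A @ B @ (c', False) # W'"
  have red1: "reduced (P @ (c, False) # finv A)"
    using Cons.prems(2)[of "(P, c)"] M(1)
    by (intro reduced_appendD(1)[of "P @ (c, False) # finv A" "finv M"]) simp
  have "reduced (M @ B @ (c', False) # W')"
    using reduced_reduce[of "concat (map ?cw ((P', c') # L))"] unfolding W'(1) by (simp add: M(2))
  then have red2: "reduced (B @ (c', False) # W')" by (simp add: reduced_append)
  \<comment> \<open>If \<open>A\<close> is empty, a clash would put t_c^-1 at the start of
    \<open>B\<close>; if \<open>B\<close> is empty, it would put t_c' at the start of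
    \<open>A\<close>. Both contradict \<open>na\<close>. If neither is empty, maximality of
    \<open>M\<close> excludes it.\<close>
  have junction: "hd (B @ (c', False) # W') \<noteq> flip (last ((c, False) # finv A))"
  proof (cases "A = []")
    case True
    have "hd B \<noteq> (c, True)" if "B \<noteq> []"
      using na that M True by (cases B) (auto simp: no_absorption_def)
    with True show ?thesis by (cases B) auto
  next
    case False
    have "hd A \<noteq> (c', False)" if "B = []"
      using na that M False by (cases A) (auto simp: no_absorption_def)
    with False M(3) show ?thesis by (cases B) (auto simp: last_finv)
  qed
  have "reduced ((P @ (c, False) # finv A) @ (B @ (c', False) # W'))"
    unfolding reduced_append[of "P @ (c, False) # finv A"] using red1 red2 junction by auto
  then have red: "reduced (P @ (c, False) # W)" by (simp add: W_def)
  have "reduce (concat (map ?cw ((P, c) # x # L))) = reduce (conj_word P c @ P' @ (c', False) # W')"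
    using W'(1) x reduce_append_reduce_right[of "conj_word P c" "concat (map ?cw ((P', c') # L))"]
    by (simp del: reduce_append_reduce_right)
  also have "\<dots> = reduce ((P @ (c, False) # finv A) @ finv M @ M @ B @ (c', False) # W')"
    by (simp add: M)
  also have "\<dots> = reduce ((P @ (c, False) # finv A) @ B @ (c', False) # W')"
    by (rule reduce_append_finv_cancel)
  also have "\<dots> = P @ (c, False) # W"
    using red by (simp add: W_def)
  finally have eq: "reduce (concat (map ?cw ((P, c) # x # L))) = P @ (c, False) # W" .
  have "letter_count k P \<le> letter_count k W" for k
    using W'(2)[rule_format, of k] by (simp add: M W_def)
  moreover have "length (x # L) \<le> length W" using W'(3) by (simp add: W_def)
  moreover have "\<forall>y\<in>set ((P, c) # x # L). fst y = []" if "length W = length (x # L)"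
  proof -
    from that have "length A + (length B + length W') = length L" by (simp add: W_def)
    with W'(3) have "length W' = length L" "length A = 0" "length B = 0" by linarith+
    with W'(4) M x show ?thesis by auto
  qed
  ultimately show ?case using eq by blast
qed

section \<open>Tuples of generator images\<close>

abbreviation full_product :: "nat \<Rightarrow> word" where
  "full_product n \<equiv> map (\<lambda>i. (i, False)) [1..<Suc n]"

text \<open>Artin's conditions on the images of the generators under a braid automorphism, in a form
  preserved by the descent moves.\<close>

definition braid_tuple :: "nat \<Rightarrow> (nat \<Rightarrow> word) \<Rightarrow> bool" where
  "braid_tuple n g \<longleftrightarrow> (\<forall>i\<in>{1..n}. g i \<in> F n \<and> (\<exists>P c. g i = conj_word P c))
     \<and> reduce (concat (map g [1..<Suc n])) = full_product n"

lemma successively_upt: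
  assumes "\<And>i. a \<le> i \<Longrightarrow> Suc i < b \<Longrightarrow> R i (Suc i)"
  shows "successively R [a..<b]"
  using assms
proof (induction b)
  case (Suc b)
  then show ?case by (cases b) (auto simp: successively_append_iff)
qed simp

lemma upt_1_Suc: "1 \<le> n \<Longrightarrow> [1..<Suc n] = 1 # [2..<Suc n]"
  by (metis Suc_1 Suc_eq_plus1 le_imp_less_Suc upt_conv_Cons One_nat_def)

text \<open>If the images \<open>g\<^sub>2, \<dots>, g\<^sub>n\<close> do not absorb one another, their product is
  tight, and it equals \<open>g\<^sub>1\<^sup>-\<^sup>1 t\<^sub>1 \<cdots> t\<^sub>n\<close>. If \<open>P\<^sub>2\<close> started with \<open>P\<^sub>1 c\<^sub>1\<^sup>-\<^sup>1\<close>, the letters \<open>t\<^sub>1\<^sup>\<plusminus>\<^sup>1\<close> of \<open>P\<^sub>1\<close>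
  would all have to reappear in the tail of that product, but the initial \<open>t\<^sub>1\<close> of \<open>P\<^sub>1\<close> was cancelled.\<close>

lemma absorption_at_first:
  assumes n: "1 \<le> n" and tup: "braid_tuple n g"
    and g: "\<And>i. 1 \<le> i \<Longrightarrow> i \<le> n \<Longrightarrow> g i = conj_word (P i) (c i)"
    and start: "g 1 = (1, False) # w"
    and na: "\<And>i. 2 \<le> i \<Longrightarrow> i < n \<Longrightarrow> no_absorption (P i, c i) (P (Suc i), c (Suc i))"
  shows "(\<forall>i\<in>{1..n}. g i = gen i) \<or> 2 \<le> n \<and> prefix (P 2 @ [(c 2, False)]) (P 1)"
proof -
  let ?T = "full_product n"
  let ?y = "concat (map g [2..<Suc n])"
  have redg: "reduced (conj_word (P i) (c i))" if "1 \<le> i" "i \<le> n" for i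
  proof -
    have "g i \<in> F n" using tup that by (simp add: braid_tuple_def)
    then show ?thesis unfolding g[OF that] by (simp add: F_iff)
  qed
  have g1: "g 1 = conj_word (P 1) (c 1)" using g n by simp
  have redT: "reduced ?T" by (rule reduced_positive) auto
  have "reduce (g 1 @ ?y) = ?T"
    using tup n by (simp only: braid_tuple_def upt_1_Suc list.map concat.simps)
  then have "reduce (finv (g 1) @ g 1 @ ?y) = reduce (finv (g 1) @ ?T)"
    by (metis reduce_append_reduce_right)
  then have y: "reduce ?y = reduce (finv (g 1) @ ?T)" by simp
  \<comment> \<open>\<open>S\<close> is what cancels when P_1^-1 at the end of g_1^-1 meets
    t_1...t_n.\<close>
  obtain S R T' where S: "P 1 = S @ R" "?T = S @ T'" "R = [] \<or> T' = [] \<or> hd R \<noteq> hd T'"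
    using longest_common_prefix by blast
  have redT': "reduced T'" using redT S(2) by (simp only: reduced_append)
  have "finv (g 1) @ ?T = (P 1 @ (c 1, True) # finv R) @ finv S @ S @ T'"
    using S by (simp only: g1) simp
  then have y': "reduce ?y = reduce (P 1 @ (c 1, True) # finv R @ T')"
    using y reduce_append_finv_cancel(2)[of "P 1 @ (c 1, True) # finv R" S T'] by simp
  have red_inv: "reduced (P 1 @ (c 1, True) # finv (P 1))"
    using redg[of 1] n reduced_finv[of "conj_word (P 1) (c 1)"] by simp
  have tight: "\<exists>W. reduce ?y = P 2 @ (c 2, False) # W
    \<and> (\<forall>k. letter_count k (P 2) \<le> letter_count k W) \<and> n - 2 \<le> length W
    \<and> (length W = n - 2 \<longrightarrow> (\<forall>i\<in>{2..n}. P i = []))" if "2 \<le> n"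
  proof -
    let ?L = "map (\<lambda>i. (P i, c i)) [3..<Suc n]"
    have upt: "[2..<Suc n] = 2 # [3..<Suc n]"
      using that upt_conv_Cons[of 2 "Suc n"] by (simp add: numeral_3_eq_3)
    then have L: "(P 2, c 2) # ?L = map (\<lambda>i. (P i, c i)) [2..<Suc n]" by simp
    have "successively no_absorption ((P 2, c 2) # ?L)"
      unfolding L successively_map by (rule successively_upt) (auto intro!: na)
    moreover have "reduced (conj_word (fst x) (snd x))" if "x \<in> set ((P 2, c 2) # ?L)" for x
      using that redg unfolding L by (auto simp del: upt_Suc)
    ultimately obtain W where W:
      "reduce (concat (map (\<lambda>x. conj_word (fst x) (snd x)) ((P 2, c 2) # ?L))) = P 2 @ (c 2, False) # W"
      "\<forall>k. letter_count k (P 2) \<le> letter_count k W" "length ?L \<le> length W"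
      "length W = length ?L \<longrightarrow> (\<forall>x\<in>set ((P 2, c 2) # ?L). fst x = [])"
      using tight_product by blast
    have "map (\<lambda>x. conj_word (fst x) (snd x)) ((P 2, c 2) # ?L) = map g [2..<Suc n]"
      unfolding L using g by (auto simp del: upt_Suc)
    moreover have "(\<forall>x\<in>set ((P 2, c 2) # ?L). fst x = []) \<longleftrightarrow> (\<forall>i\<in>{2..n}. P i = [])"
      unfolding L by (auto simp del: upt_Suc)
    moreover have "length ?L = n - 2" using that by (simp del: upt_Suc)
    ultimately show ?thesis using W by (intro exI[of _ W]) simp
  qed
  show ?thesis
  \<comment> \<open>The one case with further cancellation: all of P_1^-1 is used up and c_1^-1
    meets its inverse.\<close>
  proof (cases "R = [] \<and> T' \<noteq> [] \<and> hd T' = (c 1, False)")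
    case True
    then obtain T'' where T'': "T' = (c 1, False) # T''" by (cases T') auto
    have T: "?T = P 1 @ (c 1, False) # T''" using S True T'' by simp
    have pos: "\<not> snd a" if "a \<in> set (P 1 @ T'')" for a
    proof -
      have "a \<in> set ?T" unfolding T using that by auto
      then show ?thesis by auto
    qed
    have "reduce ?y = reduce (P 1 @ T'')"
      using y' True T'' reduce_append_cancel(1)[of "P 1" "(c 1, True)" T''] by simp
    also have "\<dots> = P 1 @ T''" using pos by (intro reduce_reduced reduced_positive)
    finally have yeq: "reduce ?y = P 1 @ T''" .
    have len: "length (P 1 @ T'') = n - 1"
      using arg_cong[OF T, of length] by (simp del: upt_Suc)
    show ?thesis
    proof (cases "2 \<le> n")
      case False
      with n have "n = 1" by simp
      with len T have "P 1 = []" "c 1 = 1" by auto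
      with g1 \<open>n = 1\<close> show ?thesis by (simp add: gen_def)
    next
      case n2: True
      then obtain W where W: "reduce ?y = P 2 @ (c 2, False) # W" "n - 2 \<le> length W"
        "length W = n - 2 \<longrightarrow> (\<forall>i\<in>{2..n}. P i = [])"
        using tight by blast
      \<comment> \<open>Length n - 1 is the least that \<open>tight\<close> permits, and it is
        attained only when all P_i with i at least 2 are empty.\<close>
      have "length (P 2 @ (c 2, False) # W) = n - 1" using W(1) yeq len by simp
      with W(2,3) n2 have Pi: "\<forall>i\<in>{2..n}. P i = []" by auto
      then have P2: "P 2 = []" using n2 by auto
      show ?thesis
      \<comment> \<open>If P_1 is nonempty, its first letter is t_c for c = \<open>c 2\<close>,
        which is the required absorption as P_2 is empty. Otherwise all conjugators are empty and
        comparing letters makes the tuple trivial.\<close>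
      proof (cases "P 1 = []")
        case False
        have "P 1 @ T'' = (c 2, False) # W" using W(1) yeq P2 by simp
        with False P2 n2 show ?thesis by (cases "P 1") auto
      next
        case P1: True
        have "(1, False) # map (\<lambda>i. (i, False)) [2..<Suc n] = (c 1, False) # T''"
          using T P1 n by (simp only: upt_1_Suc) simp
        then have c1: "c 1 = 1" and T2: "T'' = map (\<lambda>i. (i, False)) [2..<Suc n]" by auto
        have "?y = concat (map (\<lambda>i. [(c i, False)]) [2..<Suc n])"
          using g Pi by (intro arg_cong[where f = concat] map_cong) auto
        also have "\<dots> = map (\<lambda>i. (c i, False)) [2..<Suc n]" by (induction n) auto
        finally have "?y = map (\<lambda>i. (c i, False)) [2..<Suc n]" .
        moreover from this have "reduce ?y = ?y"
          by (intro reduce_reduced reduced_positive) auto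
        ultimately have "map (\<lambda>i. (c i, False)) [2..<Suc n] = map (\<lambda>i. (i, False)) [2..<Suc n]"
          using yeq P1 T2 by simp
        then have ci: "c i = i" if "2 \<le> i" "i \<le> n" for i
          using that by (auto simp del: upt_Suc)
        have "g i = gen i" if "1 \<le> i" "i \<le> n" for i
        proof (cases "i = 1")
          case True
          with g1 P1 c1 show ?thesis by (simp add: gen_def)
        next
          case False
          with that Pi ci[of i] g[of i] show ?thesis by (simp add: gen_def)
        qed
        then show ?thesis by auto
      qed
    qed
  next
    case False
    have "reduced (P 1 @ (c 1, True) # finv R)"
      using red_inv S(1)
      by (intro reduced_appendD(1)[of "P 1 @ (c 1, True) # finv R" "finv S"]) simp
    moreover have "hd T' \<noteq> flip (last ((c 1, True) # finv R))" if "T' \<noteq> []"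
      using False S(3) that by (cases "R = []") (auto simp: last_finv)
    ultimately have "reduced ((P 1 @ (c 1, True) # finv R) @ T')"
      unfolding reduced_append[of "P 1 @ (c 1, True) # finv R"] using redT' by auto
    then have yeq: "reduce ?y = P 1 @ (c 1, True) # finv R @ T'"
      using y' by simp
    have n2: "2 \<le> n"
    proof (rule ccontr)
      assume "\<not> 2 \<le> n"
      with n yeq show False by simp
    qed
    then obtain W where W: "reduce ?y = P 2 @ (c 2, False) # W"
      "\<forall>k. letter_count k (P 2) \<le> letter_count k W"
      using tight by blast
    from W(1) yeq have "P 2 @ (c 2, False) # W = P 1 @ (c 1, True) # finv R @ T'" by simp
    \<comment> \<open>Two factorizations of the same reduced word: one of P_1 and P_2 is a prefix of
      the other.\<close>
    then obtain us where
      us: "P 2 = P 1 @ us \<and> us @ (c 2, False) # W = (c 1, True) # finv R @ T'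
         \<or> P 2 @ us = P 1 \<and> (c 2, False) # W = us @ (c 1, True) # finv R @ T'"
      by (auto simp: append_eq_append_conv2)
    then show ?thesis
    proof
      assume us: "P 2 @ us = P 1 \<and> (c 2, False) # W = us @ (c 1, True) # finv R @ T'"
      then obtain Q where "us = (c 2, False) # Q" by (cases us) auto
      with us have "P 1 = (P 2 @ [(c 2, False)]) @ Q" by auto
      with n2 show ?thesis by (metis prefixI)
    next
      \<comment> \<open>The impossible alternative. Counting letters of index 1 gives at least as
        many in \<open>T'\<close> as in \<open>S\<close>, yet t_1...t_n has only one and it lies in
        \<open>S\<close>.\<close>
      assume us: "P 2 = P 1 @ us \<and> us @ (c 2, False) # W = (c 1, True) # finv R @ T'"
      then obtain Q where Q: "us = (c 1, True) # Q" by (cases us) auto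
      with us have "Q @ (c 2, False) # W = finv R @ T'" by simp
      from arg_cong[OF this, of "letter_count 1"]
      have "letter_count 1 W \<le> letter_count 1 R + letter_count 1 T'" by (simp split: if_splits)
      moreover have "letter_count 1 (P 1) \<le> letter_count 1 W"
        using W(2)[rule_format, of 1] us by simp
      moreover have "letter_count 1 (P 1) = letter_count 1 S + letter_count 1 R" using S(1) by simp
      ultimately have le: "letter_count 1 S \<le> letter_count 1 T'" by simp
      have Tcons: "?T = (1, False) # map (\<lambda>i. (i, False)) [2..<Suc n]"
        using n by (simp only: upt_1_Suc list.map)
      \<comment> \<open>Both g_1 and t_1...t_n start with t_1. With \<open>S\<close> empty, either
        P_1 starts with t_1, against maximality of \<open>S\<close>, or P_1 is empty and c_1 = 1,
        which is the case already treated.\<close>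
      have "S \<noteq> []"
      proof
        assume "S = []"
        with S(1,2) Tcons have "R = P 1" "T' \<noteq> []" "hd T' = (1, False)" by auto
        with S(3) False g1 start show False by (cases "P 1") auto
      qed
      with S(2) Tcons have "hd S = (1, False)" by (cases S) auto
      with \<open>S \<noteq> []\<close> have "letter_count 1 S \<ge> 1" by (cases S) auto
      moreover have "letter_count 1 ?T = 1"
        unfolding Tcons by (simp add: filter_empty_conv del: upt_Suc)
      then have "letter_count 1 S + letter_count 1 T' = 1" unfolding S(2) by simp
      ultimately show ?thesis using le by simp
    qed
  qed
qed

section \<open>Descent\<close>

lemma comp_braid_img:
  assumes "1 \<le> fst a" "fst a \<le> n - 1"
    and "\<And>k. 1 \<le> k \<Longrightarrow> k \<le> n \<Longrightarrow> reduce (subst h (braid_img a k)) = reduce (g k)"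
  shows "ext_hom n g = comp_aut n (ext_hom n (braid_img a)) (ext_hom n h)"
  by (subst comp_ext_hom) (auto intro!: ext_hom_cong braid_img_words assms(1,2) simp: assms(3))

lemma upt_split_pair:
  assumes "1 \<le> i" "i < n"
  shows "[1..<Suc n] = [1..<i] @ [i, Suc i] @ [Suc (Suc i)..<Suc n]"
proof -
  have "[1..<Suc n] = [1..<i] @ [i..<Suc n]"
    using assms upt_add_eq_append[of 1 i "Suc n - i"] by simp
  also have "[i..<Suc n] = [i, Suc i] @ [Suc (Suc i)..<Suc n]"
    using assms by (simp add: upt_conv_Cons del: upt_Suc)
  finally show ?thesis .
qed

lemma braid_tuple_replace_pair:
  assumes tup: "braid_tuple n g" and i: "1 \<le> i" "i < n"
    and u: "\<exists>P c. u = conj_word P c" "u \<in> F n" and v: "\<exists>P c. v = conj_word P c" "v \<in> F n"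
    and uv: "reduce (u @ v) = reduce (g i @ g (Suc i))"
  shows "braid_tuple n (g(i := u, Suc i := v))"
proof -
  let ?h = "g(i := u, Suc i := v)"
  let ?A = "concat (map g [1..<i])" and ?B = "concat (map g [Suc (Suc i)..<Suc n])"
  have "map ?h [1..<i] = map g [1..<i]" "map ?h [Suc (Suc i)..<Suc n] = map g [Suc (Suc i)..<Suc n]"
    by (auto simp del: upt_Suc)
  then have "concat (map ?h [1..<Suc n]) = ?A @ (u @ v) @ ?B"
    unfolding upt_split_pair[OF i] by (simp only: map_append concat_append) simp
  moreover have "concat (map g [1..<Suc n]) = ?A @ (g i @ g (Suc i)) @ ?B"
    unfolding upt_split_pair[OF i] by (simp del: upt_Suc)
  moreover have "reduce (?A @ (u @ v) @ ?B) = reduce (?A @ (g i @ g (Suc i)) @ ?B)"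
    by (intro reduce_append_cong refl uv)
  ultimately have "reduce (concat (map ?h [1..<Suc n])) = full_product n"
    using tup by (simp only: braid_tuple_def)
  with tup u v show ?thesis by (auto simp: braid_tuple_def simp del: upt_Suc)
qed

lemma sum_replace_pair_less:
  fixes f :: "nat \<Rightarrow> 'a" and m :: "'a \<Rightarrow> nat"
  assumes "1 \<le> i" "i < n" "m u + m v < m (f i) + m (f (Suc i))"
  shows "(\<Sum>k=1..n. m ((f(i := u, Suc i := v)) k)) < (\<Sum>k=1..n. m (f k))"
proof -
  have A: "{1..n} = insert i (insert (Suc i) ({1..n} - {i, Suc i}))" using assms by auto
  have "(\<Sum>k\<in>{1..n} - {i, Suc i}. m ((f(i := u, Suc i := v)) k)) = (\<Sum>k\<in>{1..n} - {i, Suc i}. m (f k))"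
    by (rule sum.cong) auto
  then show ?thesis using assms(3) by (subst (1 2) A) simp
qed

text \<open>The new entry is u = g_i g_(i+1) g_i^-1. Writing P' = P c^-1 Q, the product g_i P'
  collapses to P Q, so the conjugator of \<open>u\<close> loses a letter while u g_i = g_i g_(i+1)
  keeps the total product.\<close>

lemma absorption_step_positive:
  assumes tup: "braid_tuple n g" and i: "1 \<le> i" "i < n"
    and g: "g i = conj_word P c" "g (Suc i) = conj_word P' c'"
    and absorb: "prefix (P @ [(c, True)]) P'"
  obtains u where "braid_tuple n (g(i := u, Suc i := g i))"
    "ext_hom n g = comp_aut n (ext_hom n (braid_img (i, False))) (ext_hom n (g(i := u, Suc i := g i)))"
    "length u < length (g (Suc i))"
proof -
  from absorb obtain Q where Q: "P' = P @ (c, True) # Q" by (auto simp: prefix_def)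
  define u where "u = reduce (conj_word (P @ Q) c')"
  let ?h = "g(i := u, Suc i := g i)"
  have gF: "g k \<in> F n" "\<exists>P c. g k = conj_word P c" if "1 \<le> k" "k \<le> n" for k
    using tup that by (auto simp: braid_tuple_def)
  have "g i @ g (Suc i) @ finv (g i)
      = (P @ [(c, False)]) @ finv P @ P @ (c, True) # Q @ (c', False) # finv Q @ (c, False) # finv P @ P @ (c, True) # finv P"
    by (simp add: g Q)
  then have "reduce (g i @ g (Suc i) @ finv (g i))
      = reduce ((P @ [(c, False)]) @ (c, True) # Q @ (c', False) # finv Q @ (c, False) # finv P @ P @ (c, True) # finv P)"
    by (simp only: reduce_append_finv_cancel)
  also have "\<dots> = reduce ((P @ (c, False) # (c, True) # Q @ (c', False) # finv Q @ [(c, False)]) @ finv P @ P @ (c, True) # finv P)"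
    by simp
  also have "\<dots> = reduce (P @ (c, False) # flip (c, False) # Q @ (c', False) # finv Q @ (c, False) # (c, True) # finv P)"
    by (simp only: reduce_append_finv_cancel) simp
  also have "\<dots> = reduce ((P @ Q @ (c', False) # finv Q) @ (c, False) # flip (c, False) # finv P)"
    by (simp only: reduce_append_cancel(1)[of P]) simp
  also have "\<dots> = u" by (simp only: reduce_append_cancel) (simp add: u_def)
  finally have u: "reduce (g i @ g (Suc i) @ finv (g i)) = u" .
  have uconj: "reduce (u @ v) = reduce (g i @ g (Suc i) @ finv (g i) @ v)" for v
    using u reduce_append_reduce_left[of "g i @ g (Suc i) @ finv (g i)" v] by simp
  have "u \<in> F n" unfolding u[symmetric] using gF[of i] gF[of "Suc i"] i by (auto simp: F_words)
  moreover have "reduce (u @ g i) = reduce (g i @ g (Suc i))"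
    using uconj[of "g i"] reduce_append_finv_cancel(2)[of "g i @ g (Suc i)" "g i" "[]"] by simp
  ultimately have "braid_tuple n ?h"
    using conj_word_normal_form[of "P @ Q" c'] gF[of i] i
    by (intro braid_tuple_replace_pair[OF tup i]) (auto simp: u_def)
  moreover have "reduce (subst ?h (braid_img (i, False) k)) = reduce (g k)" for k
  proof (cases "k = Suc i")
    case True
    have "reduce (finv (g i) @ u @ g i) = reduce (finv (g i) @ g i @ g (Suc i))"
      by (rule reduce_append_cong[OF refl \<open>reduce (u @ g i) = reduce (g i @ g (Suc i))\<close>])
    with True show ?thesis by (simp add: braid_img_def)
  qed (auto simp: braid_img_def Let_def)
  then have "ext_hom n g = comp_aut n (ext_hom n (braid_img (i, False))) (ext_hom n ?h)"
    using i by (intro comp_braid_img) auto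
  moreover have "length u < length (g (Suc i))"
    using length_reduce[of "conj_word (P @ Q) c'"] by (simp add: u_def g Q)
  ultimately show ?thesis by (rule that)
qed

text \<open>Symmetric to the positive step, with u = g_(i+1)^-1 g_i g_(i+1): writing P = P' c' Q,
  the product g_(i+1)^-1 P collapses to P' Q.\<close>

lemma absorption_step_negative:
  assumes tup: "braid_tuple n g" and i: "1 \<le> i" "i < n"
    and g: "g i = conj_word P c" "g (Suc i) = conj_word P' c'"
    and absorb: "prefix (P' @ [(c', False)]) P"
  obtains u where "braid_tuple n (g(i := g (Suc i), Suc i := u))"
    "ext_hom n g = comp_aut n (ext_hom n (braid_img (i, True))) (ext_hom n (g(i := g (Suc i), Suc i := u)))"
    "length u < length (g i)"
proof -
  from absorb obtain Q where Q: "P = P' @ (c', False) # Q" by (auto simp: prefix_def)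
  define u where "u = reduce (conj_word (P' @ Q) c)"
  let ?b = "g (Suc i)"
  let ?h = "g(i := ?b, Suc i := u)"
  have gF: "g k \<in> F n" "\<exists>P c. g k = conj_word P c" if "1 \<le> k" "k \<le> n" for k
    using tup that by (auto simp: braid_tuple_def)
  have "finv ?b @ g i @ ?b
      = (P' @ [(c', True)]) @ finv P' @ P' @ (c', False) # Q @ (c, False) # finv Q @ (c', True) # finv P' @ P' @ (c', False) # finv P'"
    by (simp add: g Q)
  then have "reduce (finv ?b @ g i @ ?b)
      = reduce ((P' @ [(c', True)]) @ (c', False) # Q @ (c, False) # finv Q @ (c', True) # finv P' @ P' @ (c', False) # finv P')"
    by (simp only: reduce_append_finv_cancel)
  also have "\<dots> = reduce ((P' @ (c', True) # (c', False) # Q @ (c, False) # finv Q @ [(c', True)]) @ finv P' @ P' @ (c', False) # finv P')"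
    by simp
  also have "\<dots> = reduce (P' @ (c', True) # flip (c', True) # Q @ (c, False) # finv Q @ (c', True) # (c', False) # finv P')"
    by (simp only: reduce_append_finv_cancel) simp
  also have "\<dots> = reduce ((P' @ Q @ (c, False) # finv Q) @ (c', True) # flip (c', True) # finv P')"
    by (simp only: reduce_append_cancel(1)[of P']) simp
  also have "\<dots> = u" by (simp only: reduce_append_cancel) (simp add: u_def)
  finally have u: "reduce (finv ?b @ g i @ ?b) = u" .
  have "u \<in> F n" unfolding u[symmetric] using gF[of i] gF[of "Suc i"] i by (auto simp: F_words)
  have bu: "reduce (?b @ u) = reduce (g i @ ?b)"
    unfolding u[symmetric] by simp
  have "braid_tuple n ?h"
    using conj_word_normal_form[of "P' @ Q" c] gF[of "Suc i"] i \<open>u \<in> F n\<close> bu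
    by (intro braid_tuple_replace_pair[OF tup i]) (auto simp: u_def)
  moreover have "reduce (subst ?h (braid_img (i, True) k)) = reduce (g k)" for k
  proof (cases "k = i")
    case True
    have "reduce ((?b @ u) @ finv ?b) = reduce ((g i @ ?b) @ finv ?b)"
      by (rule reduce_append_cong[OF bu refl])
    also have "\<dots> = reduce (g i)"
      using reduce_append_finv_cancel(1)[of "g i" ?b "[]"] by simp
    finally show ?thesis using True by (simp add: braid_img_def)
  qed (auto simp: braid_img_def Let_def)
  then have "ext_hom n g = comp_aut n (ext_hom n (braid_img (i, True))) (ext_hom n ?h)"
    using i by (intro comp_braid_img) auto
  moreover have "length u < length (g i)"
    using length_reduce[of "conj_word (P' @ Q) c"] by (simp add: u_def g Q)
  ultimately show ?thesis by (rule that)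
qed

text \<open>Induction on the total length of the tuple, splitting off one braid letter per step.
  Index 1 is touched only when no move of index at least 2 is possible, and then
  \<open>absorption_at_first\<close> yields an inverse of sigma_1.\<close>

lemma braid_tuple_nonpos:
  assumes "1 \<le> n" "braid_tuple n g" "g 1 = (1, False) # w"
  shows "\<exists>ws\<in>nonpos_words n. ext_hom n g = aut_prod n ws"
  using assms(2,3)
proof (induction "\<Sum>k=1..n. length (g k)" arbitrary: g w rule: less_induct)
  case less
  from less.prems(1) have "\<forall>i\<in>{1..n}. \<exists>x. g i = conj_word (fst x) (snd x)"
    unfolding braid_tuple_def by (metis fst_conv snd_conv)
  then obtain x where x: "\<forall>i\<in>{1..n}. g i = conj_word (fst (x i)) (snd (x i))"
    by (rule bchoice[THEN exE])
  define P where "P i = fst (x i)" for i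
  define c where "c i = snd (x i)" for i
  have g: "g i = conj_word (P i) (c i)" if "1 \<le> i" "i \<le> n" for i
    using x that by (simp add: P_def c_def)
  have step: ?case
    if h: "braid_tuple n h" "h 1 = (1, False) # w'" "(\<Sum>k=1..n. length (h k)) < (\<Sum>k=1..n. length (g k))"
      and a: "1 \<le> fst a" "fst a \<le> n - 1" "a \<noteq> (1, False)"
      and eq: "ext_hom n g = comp_aut n (ext_hom n (braid_img a)) (ext_hom n h)" for h w' a
  proof -
    from less.hyps[OF h(3,1,2)] obtain ws where "ws \<in> nonpos_words n" "ext_hom n h = aut_prod n ws"
      by blast
    with a eq have "a # ws \<in> nonpos_words n" "ext_hom n g = aut_prod n (a # ws)"
      by (simp_all add: aut_prod_Cons del: aut_prod.simps)
    then show ?thesis by blast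
  qed
  show ?case
  proof (cases "\<exists>i. 2 \<le> i \<and> i < n \<and> \<not> no_absorption (P i, c i) (P (Suc i), c (Suc i))")
    case True
    then obtain i where i: "2 \<le> i" "i < n" and abs: "\<not> no_absorption (P i, c i) (P (Suc i), c (Suc i))"
      by blast
    then have i1: "1 \<le> i" and gi: "g i = conj_word (P i) (c i)" "g (Suc i) = conj_word (P (Suc i)) (c (Suc i))"
      using g by auto
    from abs consider "prefix (P i @ [(c i, True)]) (P (Suc i))" | "prefix (P (Suc i) @ [(c (Suc i), False)]) (P i)"
      by (auto simp: no_absorption_def)
    then show ?thesis
    proof cases
      case 1
      from absorption_step_positive[OF less.prems(1) i1 i(2) gi 1] obtain u where
        u: "braid_tuple n (g(i := u, Suc i := g i))"
        "ext_hom n g = comp_aut n (ext_hom n (braid_img (i, False))) (ext_hom n (g(i := u, Suc i := g i)))"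
        "length u < length (g (Suc i))" .
      have "(\<Sum>k=1..n. length ((g(i := u, Suc i := g i)) k)) < (\<Sum>k=1..n. length (g k))"
        using u(3) i1 i(2) by (intro sum_replace_pair_less) auto
      then show ?thesis using less.prems(2) i by (intro step[OF u(1) _ _ _ _ _ u(2)]) auto
    next
      case 2
      from absorption_step_negative[OF less.prems(1) i1 i(2) gi 2] obtain u where
        u: "braid_tuple n (g(i := g (Suc i), Suc i := u))"
        "ext_hom n g = comp_aut n (ext_hom n (braid_img (i, True))) (ext_hom n (g(i := g (Suc i), Suc i := u)))"
        "length u < length (g i)" .
      have "(\<Sum>k=1..n. length ((g(i := g (Suc i), Suc i := u)) k)) < (\<Sum>k=1..n. length (g k))"
        using u(3) i1 i(2) by (intro sum_replace_pair_less) auto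
      then show ?thesis using less.prems(2) i by (intro step[OF u(1) _ _ _ _ _ u(2)]) auto
    qed
  next
    case False
    then have "(\<forall>i\<in>{1..n}. g i = gen i) \<or> 2 \<le> n \<and> prefix (P 2 @ [(c 2, False)]) (P 1)"
      by (intro absorption_at_first[OF assms(1) less.prems(1) g less.prems(2)]) auto
    then show ?thesis
    proof
      assume "\<forall>i\<in>{1..n}. g i = gen i"
      then have "ext_hom n g = aut_prod n []"
        unfolding aut_prod.simps id_aut_ext_hom by (intro ext_hom_cong) auto
      then show ?thesis by (intro bexI[of _ "[]"]) auto
    next
      assume abs: "2 \<le> n \<and> prefix (P 2 @ [(c 2, False)]) (P 1)"
      then have g12: "g 1 = conj_word (P 1) (c 1)" "g (Suc 1) = conj_word (P 2) (c 2)"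
        using g[of 1] g[of 2] by (simp_all add: numeral_2_eq_2)
      from abs have n2: "1 < n" and abs: "prefix (P 2 @ [(c 2, False)]) (P 1)" by auto
      from absorption_step_negative[OF less.prems(1) _ n2 g12 abs] obtain u where
        u: "braid_tuple n (g(1 := g (Suc 1), Suc 1 := u))"
        "ext_hom n g = comp_aut n (ext_hom n (braid_img (1, True))) (ext_hom n (g(1 := g (Suc 1), Suc 1 := u)))"
        "length u < length (g 1)" by auto
      have less: "(\<Sum>k=1..n. length ((g(1 := g (Suc 1), Suc 1 := u)) k)) < (\<Sum>k=1..n. length (g k))"
        using u(3) n2 by (intro sum_replace_pair_less) auto
      \<comment> \<open>The new first entry is g_2. The nonempty word P_2 c_2 is a prefix of P_1, so
        g_2 has the same first letter t_1 as g_1 and the induction hypothesis applies.\<close>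
      obtain w' where w': "(g(1 := g (Suc 1), Suc 1 := u)) 1 = (1, False) # w'"
        using abs less.prems(2) unfolding g12 prefix_def by (cases "P 2") auto
      from n2 show ?thesis by (intro step[OF u(1) w' less _ _ _ u(2)]) auto
    qed
  qed
qed

section \<open>The mirror involution\<close>

abbreviation seg :: "nat \<Rightarrow> nat \<Rightarrow> word" where
  "seg a b \<equiv> map (\<lambda>i. (i, False)) [a..<b]"

text \<open>Chosen so that t_1...t_k goes to its inverse for every k; see
  \<open>mirror_seg\<close>.\<close>

definition mirror_img :: "nat \<Rightarrow> word" where
  "mirror_img k = seg 1 k @ (k, True) # finv (seg 1 k)"

lemma reduced_seg_append:
  assumes "reduced v" "v \<noteq> [] \<Longrightarrow> a < b \<Longrightarrow> hd v \<noteq> (b - 1, True)"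
  shows "reduced (seg a b @ v)"
proof (cases "a < b")
  case True
  then have "last (seg a b) = (b - 1, False)" by (simp add: last_map last_upt)
  moreover have "reduced (seg a b)" by (rule reduced_positive) auto
  ultimately show ?thesis using assms True by (auto simp: reduced_append)
qed (simp add: assms)

lemma reduced_finv_seg_append:
  assumes "reduced v" "v \<noteq> [] \<Longrightarrow> a < b \<Longrightarrow> hd v \<noteq> (a, False)"
  shows "reduced (finv (seg a b) @ v)"
proof (cases "a < b")
  case True
  then have "last (finv (seg a b)) = (a, True)" by (simp add: last_finv hd_map)
  moreover have "reduced (seg a b)" by (rule reduced_positive) auto
  ultimately show ?thesis using assms True by (auto simp: reduced_append)
qed (simp add: assms)

lemma seg_append: "a \<le> b \<Longrightarrow> b \<le> c \<Longrightarrow> seg a c = seg a b @ seg b c"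
  by (metis map_append upt_add_eq_append le_add_diff_inverse)

text \<open>Invariant for a reduced image t_1...t_(h-1) v of \<open>w\<close>. It implies that
  \<open>v\<close> starts neither with t_h, which would lengthen the run, nor with t_(h-1)^-1, which
  would cancel into it.\<close>

definition mirror_head :: "word \<Rightarrow> nat \<Rightarrow> word \<Rightarrow> bool" where
  "mirror_head w h v \<longleftrightarrow>
     (w = [] \<longrightarrow> h = 1 \<and> v = []) \<and>
     (w \<noteq> [] \<longrightarrow> snd (hd w) \<longrightarrow> h = Suc (fst (hd w)) \<and> (v \<noteq> [] \<longrightarrow> fst (hd v) < fst (hd w) \<or> hd v = flip (hd w))) \<and>
     (w \<noteq> [] \<longrightarrow> \<not> snd (hd w) \<longrightarrow> h = fst (hd w) \<and> v \<noteq> [] \<and> (fst (hd w) < fst (hd v) \<or> hd v = flip (hd w)))"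

text \<open>A new letter of index \<open>k\<close> multiplies the image by a word ending in
  (t_1...t_(k-1))^-1. This meets the run t_1...t_(h-1) and leaves \<open>finv (seg h k)\<close> or
  \<open>seg k h\<close>, according to the order of \<open>h\<close> and \<open>k\<close>.\<close>

lemma mirror_initial_segment:
  assumes "reduced w" "w \<in> words n"
  shows "\<exists>h v. 1 \<le> h \<and> reduce (subst mirror_img w) = seg 1 h @ v \<and> mirror_head w h v"
  using assms
proof (induction w)
  case Nil
  then show ?case by (intro exI[of _ 1] exI[of _ "[]"]) (simp add: mirror_head_def)
next
  case (Cons a w)
  obtain k b where a: "a = (k, b)" by (cases a)
  from Cons.prems a have k: "1 \<le> k" and w: "reduced w" "w \<in> words n"
    and hdw: "w \<noteq> [] \<Longrightarrow> hd w \<noteq> (k, \<not> b)" by (auto simp: reduced_Cons)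
  from Cons.IH[OF w] obtain h v where
    h: "1 \<le> h" and v: "reduce (subst mirror_img w) = seg 1 h @ v" and mh: "mirror_head w h v"
    by blast
  have redv: "reduced v" using reduced_reduce[of "subst mirror_img w"] unfolding v by (rule reduced_appendD)
  have hd1: "hd v \<noteq> (h, False)" if "v \<noteq> []"
    using mh that by (cases "hd w"; cases "w = []") (auto simp: mirror_head_def)
  have hd2: "hd v \<noteq> (h - 1, True)" if "v \<noteq> []"
    using mh that h by (cases "hd w"; cases "w = []") (auto simp: mirror_head_def)
  have eq: "reduce (subst mirror_img (a # w)) = reduce (seg 1 k @ (k, \<not> b) # finv (seg 1 k) @ seg 1 h @ v)"
    using reduce_append_reduce_right[of "subst mirror_img [a]" "subst mirror_img w"]
    unfolding v a by (cases b) (simp_all add: mirror_img_def del: reduce_append_reduce_right)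
  have eq1: "reduce (subst mirror_img (a # w)) = reduce (seg 1 k @ (k, \<not> b) # finv (seg h k) @ v)" if "h \<le> k"
  proof -
    have "seg 1 k = seg 1 h @ seg h k" using h that by (rule seg_append)
    then have "seg 1 k @ (k, \<not> b) # finv (seg 1 k) @ seg 1 h @ v
      = (seg 1 k @ (k, \<not> b) # finv (seg h k)) @ finv (seg 1 h) @ seg 1 h @ v" by simp
    then show ?thesis unfolding eq by (simp only: reduce_append_finv_cancel) simp
  qed
  have eq2: "reduce (subst mirror_img (a # w)) = reduce (seg 1 k @ (k, \<not> b) # seg k h @ v)" if "k \<le> h"
  proof -
    have "seg 1 h = seg 1 k @ seg k h" using k that by (rule seg_append)
    then have "seg 1 k @ (k, \<not> b) # finv (seg 1 k) @ seg 1 h @ v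
      = (seg 1 k @ [(k, \<not> b)]) @ finv (seg 1 k) @ seg 1 k @ seg k h @ v" by simp
    then show ?thesis unfolding eq by (simp only: reduce_append_finv_cancel) simp
  qed
  show ?case
  proof (cases b)
    case True
    have Suck: "seg 1 (Suc k) = seg 1 k @ [(k, False)]" using k by simp
    show ?thesis
    proof (cases "h \<le> k")
      case hk: True
      let ?v = "finv (seg h k) @ v"
      have rv: "reduced ?v" by (rule reduced_finv_seg_append[OF redv]) (rule hd1)
      \<comment> \<open>For h = k nothing of the segment is left in front of \<open>v\<close>. The
        value h = k could come from an initial t_k of \<open>w\<close>, but \<open>a\<close> is its
        inverse and \<open>a # w\<close> is reduced.\<close>
      have hdv: "?v \<noteq> [] \<longrightarrow> fst (hd ?v) < k"
      proof (cases "h = k")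
        case True
        have "fst (hd v) < k" if ne: "v \<noteq> []"
        proof -
          obtain x w' where x: "w = x # w'" using mh ne by (cases w) (simp_all add: mirror_head_def)
          have "snd x"
          proof (rule ccontr)
            assume "\<not> snd x"
            with mh x True have "x = (k, False)" by (simp add: mirror_head_def prod_eq_iff)
            with hdw x \<open>b\<close> show False by simp
          qed
          with mh x ne True show ?thesis by (auto simp: mirror_head_def)
        qed
        with True show ?thesis by simp
      next
        case False
        then obtain j where "k = Suc j" "h \<le> j" using hk by (cases k) auto
        then show ?thesis by simp
      qed
      have "reduced (seg 1 (Suc k) @ ?v)" using rv hdv by (intro reduced_seg_append) auto
      then have "reduce (subst mirror_img (a # w)) = seg 1 (Suc k) @ ?v"
        using eq1[OF hk] True unfolding Suck by (simp del: upt_Suc)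
      moreover have "mirror_head (a # w) (Suc k) ?v" using hdv a True by (simp add: mirror_head_def)
      ultimately show ?thesis by (intro exI[of _ "Suc k"] exI[of _ ?v]) auto
    next
      case False
      let ?v = "seg k h @ v"
      have rv: "reduced ?v" using redv hd2 by (intro reduced_seg_append) auto
      have hdv: "hd ?v = (k, False)" using False by (simp add: upt_conv_Cons[of k h])
      have "reduced (seg 1 (Suc k) @ ?v)" by (rule reduced_seg_append[OF rv]) (use hdv in simp)
      then have "reduce (subst mirror_img (a # w)) = seg 1 (Suc k) @ ?v"
        using eq2 False True unfolding Suck by (simp del: upt_Suc)
      moreover have "mirror_head (a # w) (Suc k) ?v" using hdv a True by (simp add: mirror_head_def)
      ultimately show ?thesis by (intro exI[of _ "Suc k"] exI[of _ ?v]) auto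
    qed
  next
    case False
    show ?thesis
    proof (cases "h \<le> k")
      case hk: True
      let ?v = "(k, True) # finv (seg h k) @ v"
      have "finv (seg h (Suc k)) @ v = ?v" using hk by simp
      moreover have "reduced (finv (seg h (Suc k)) @ v)"
        using redv hd1 by (intro reduced_finv_seg_append) auto
      ultimately have "reduced ?v" by (simp only:)
      then have "reduced (seg 1 k @ ?v)" using k by (intro reduced_seg_append) auto
      then have "reduce (subst mirror_img (a # w)) = seg 1 k @ ?v"
        using eq1[OF hk] False by simp
      moreover have "mirror_head (a # w) k ?v" using a False by (simp add: mirror_head_def)
      ultimately show ?thesis using k by (intro exI[of _ k] exI[of _ ?v]) auto
    next
      case hk: False
      let ?v = "seg (Suc k) h @ v"
      have "seg k h = (k, False) # seg (Suc k) h" using hk by (simp add: upt_conv_Cons[of k h])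
      then have eq3: "reduce (subst mirror_img (a # w)) = reduce (seg 1 k @ ?v)"
        using eq2 hk False reduce_append_cancel(1)[of "seg 1 k" "(k, True)" ?v] by simp
      have rv: "reduced ?v" using redv hd2 by (intro reduced_seg_append) auto
      \<comment> \<open>For h = k + 1 the segment is empty again; an initial t_k^-1 of
        \<open>w\<close> is excluded because \<open>a\<close> is t_k.\<close>
      have hdv: "?v \<noteq> [] \<and> k < fst (hd ?v)"
      proof (cases "h = Suc k")
        case True
        obtain x w' where x: "w = x # w'" using mh True k by (cases w) (simp_all add: mirror_head_def)
        have "\<not> snd x"
        proof
          assume "snd x"
          with mh x True have "x = (k, True)" by (simp add: mirror_head_def prod_eq_iff)
          with hdw x \<open>\<not> b\<close> show False by simp
        qed
        with mh x True show ?thesis by (auto simp: mirror_head_def)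
      next
        case False
        then show ?thesis using hk by (simp add: upt_conv_Cons[of "Suc k" h])
      qed
      have "reduced (seg 1 k @ ?v)" by (rule reduced_seg_append[OF rv]) (use hdv in auto)
      then have "reduce (subst mirror_img (a # w)) = seg 1 k @ ?v" using eq3 by simp
      moreover have "mirror_head (a # w) k ?v" using hdv a False by (simp add: mirror_head_def)
      ultimately show ?thesis using k by (intro exI[of _ k] exI[of _ ?v]) auto
    qed
  qed
qed

text \<open>By \<open>mirror_head\<close>, h = 1 happens only when \<open>w\<close> is empty or
  starts with t_1; otherwise the run t_1...t_(h-1) is nonempty.\<close>

lemma mirror_starts_with_gen1:
  assumes "w \<in> F n" "w \<noteq> []" "hd w \<noteq> (1, False)"
  shows "\<exists>v. reduce (subst mirror_img w) = (1, False) # v"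
proof -
  from mirror_initial_segment[of w n] assms(1) obtain h v where
    h: "1 \<le> h" "reduce (subst mirror_img w) = seg 1 h @ v" "mirror_head w h v" by (auto simp: F_iff)
  from assms have "1 \<le> fst (hd w)" by (cases w) (auto simp: F_iff)
  with assms(2,3) h(3) have "1 < h"
    by (cases "hd w") (auto simp: mirror_head_def split: if_splits)
  then have "seg 1 h = (1, False) # seg 2 h" by (simp add: upt_conv_Cons numeral_2_eq_2)
  with h(2) show ?thesis by simp
qed

section \<open>The mirror is an involution and inverts the braid generators\<close>

lemma reduce_subst_arg_cong: "reduce u = reduce v \<Longrightarrow> reduce (subst f u) = reduce (subst f v)"
  by (metis reduce_subst)

lemma foldr_red_cons_cancel:
  assumes "reduced x"
  shows "foldr red_cons (finv p) (foldr red_cons p x) = x" "foldr red_cons p (foldr red_cons (finv p) x) = x"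
  using reduce_finv_cancel[of p x] assms by (simp_all add: reduce_append)

lemma mirror_img_words: "1 \<le> k \<Longrightarrow> k \<le> n \<Longrightarrow> mirror_img k \<in> words n"
  by (auto simp: mirror_img_def words_def finv_def)

lemma mirror_seg: "reduce (subst mirror_img (seg 1 k)) = reduce (finv (seg 1 k))"
proof (induction k)
  case (Suc k)
  show ?case
  proof (cases "1 \<le> k")
    case True
    then have S: "seg 1 (Suc k) = seg 1 k @ [(k, False)]" by simp
    have "reduce (subst mirror_img (seg 1 (Suc k))) = reduce (finv (seg 1 k) @ mirror_img k)"
      unfolding S using reduce_append_cong[OF Suc.IH refl, of "mirror_img k"] by simp
    also have "\<dots> = reduce (finv (seg 1 (Suc k)))"
      unfolding S mirror_img_def by simp
    finally show ?thesis .
  qed simp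
qed simp

lemma subst_mirror_img: "subst f (mirror_img k) = subst f (seg 1 k) @ finv (f k) @ finv (subst f (seg 1 k))"
  by (simp add: mirror_img_def)

lemma mirror_mirror: "reduce (subst mirror_img (mirror_img k)) = reduce (gen k)"
proof -
  let ?p = "seg 1 k"
  have "subst mirror_img (mirror_img k) = subst mirror_img ?p @ finv (mirror_img k) @ finv (subst mirror_img ?p)"
    by (rule subst_mirror_img)
  also have "reduce \<dots> = reduce (finv ?p @ finv (mirror_img k) @ finv (finv ?p))"
    by (intro reduce_append_cong refl mirror_seg) (simp only: reduce_finv mirror_seg)
  also have "\<dots> = reduce (finv ?p @ ?p @ (k, False) # finv ?p @ ?p)"
    by (simp add: mirror_img_def)
  also have "\<dots> = reduce (gen k @ finv ?p @ ?p @ [])"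
    by (simp only: reduce_finv_cancel) (simp add: gen_def)
  also have "\<dots> = reduce (gen k)"
    by (simp only: reduce_append_finv_cancel) simp
  finally show ?thesis .
qed

text \<open>A half twist fixes t_i t_(i+1) and all other generators. Only \<open>j = Suc i\<close>
  separates the pair, since \<open>seg 1 j\<close> stops at t_(j-1).\<close>

lemma braid_img_fixes_seg:
  assumes "1 \<le> fst a" "j \<noteq> Suc (fst a)"
  shows "reduce (subst (braid_img a) (seg 1 j)) = reduce (seg 1 j)"
proof -
  obtain i b where a: "a = (i, b)" by (cases a)
  have fixed: "subst (braid_img a) (seg l m) = seg l m" if "m \<le> i \<or> Suc i < l" for l m
    using that by (induction m) (auto simp: braid_img_def Let_def a gen_def)
  show ?thesis
  proof (cases "j \<le> i")
    case True
    with fixed show ?thesis by simp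
  next
    case False
    with assms a have "Suc (Suc i) \<le> j" by simp
    then have S: "seg 1 j = seg 1 i @ [(i, False), (Suc i, False)] @ seg (Suc (Suc i)) j"
      using assms(1) a seg_append[of 1 i j] by (simp add: upt_conv_Cons)
    have "reduce (subst (braid_img a) [(i, False), (Suc i, False)]) = reduce [(i, False), (Suc i, False)]"
      by (cases b) (auto simp: braid_img_def a reduce_Cons red_cons_Cons)
    then have "reduce (seg 1 i @ subst (braid_img a) [(i, False), (Suc i, False)] @ seg (Suc (Suc i)) j)
      = reduce (seg 1 i @ [(i, False), (Suc i, False)] @ seg (Suc (Suc i)) j)"
      by (intro reduce_append_cong refl)
    then show ?thesis unfolding S by (simp only: subst_simps(3) fixed[of i 1] fixed[of j "Suc (Suc i)"]) (use fixed in simp)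
  qed
qed

lemma mirror_conjugates_braid_img:
  assumes "1 \<le> fst a" "1 \<le> k"
  shows "reduce (subst (braid_img a) (mirror_img k)) = reduce (subst mirror_img (braid_img (flip a) k))"
proof -
  obtain i b where a: "a = (i, b)" by (cases a)
  have fixes_seg: "foldr red_cons (subst (braid_img a) (seg 1 j)) x = foldr red_cons (seg 1 j) x"
    "foldr red_cons (finv (subst (braid_img a) (seg 1 j))) x = foldr red_cons (finv (seg 1 j)) x"
    if "j \<noteq> Suc i" "reduced x" for j x
    using braid_img_fixes_seg[of a j] assms(1) a that foldr_reduce[OF that(2)] reduce_finv
    by (metis fst_conv)+
  have cancel: "red_cons (l, False) (red_cons (l, True) x) = x" "red_cons (l, True) (red_cons (l, False) x) = x"
    if "reduced x" for l x
    using red_cons_flip[OF that, of "(l, False)"] red_cons_flip[OF that, of "(l, True)"] by simp_all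
  have i: "1 \<le> i" using assms a by simp
  define p where "p = seg 1 i"
  have Si: "seg 1 (Suc i) = p @ [(i, False)]" using i by (simp add: p_def)
  have fixes_last: "reduce (finv (subst (braid_img a) (seg 1 j))) = reduce (finv (seg 1 j))" if "j \<noteq> Suc i" for j
    using braid_img_fixes_seg[of a j] assms(1) a that by (simp only: reduce_finv) simp
  \<comment> \<open>With words read as operators on reduced words, these rules let the simplifier
    cancel the symbolic prefix \<open>p\<close> against its inverse.\<close>
  note act = reduce_append reduce_Cons reduced_foldr reduced_red_cons foldr_red_cons_cancel cancel
  have mi: "mirror_img i = p @ (i, True) # finv p"
    and mSi: "mirror_img (Suc i) = p @ (i, False) # (Suc i, True) # (i, True) # finv p"
    unfolding mirror_img_def Si by (simp_all add: p_def)
  have fp: "foldr red_cons (subst (braid_img a) p) x = foldr red_cons p x"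
    "foldr red_cons (finv (subst (braid_img a) p)) x = foldr red_cons (finv p) x"
    if "reduced x" for x
    using fixes_seg[of i x] that by (simp_all add: p_def)
  have fp_last: "reduce (finv (subst (braid_img a) p)) = reduce (finv p)"
    using fixes_last[of i] by (simp add: p_def)
  consider "k = i" | "k = Suc i" | "k \<noteq> i" "k \<noteq> Suc i" by blast
  then show ?thesis
  proof cases
    case 3
    then have bk: "braid_img a k = gen k" "braid_img (flip a) k = gen k"
      by (simp_all add: a braid_img_def)
    have "reduce (subst (braid_img a) (mirror_img k)) = reduce (mirror_img k)"
      unfolding subst_mirror_img bk using 3 fixes_seg[of k] fixes_last[of k]
      by (simp add: mirror_img_def gen_def act del: One_nat_def)
    then show ?thesis by (simp add: bk)
  next
    case 1
    show ?thesis
    proof (cases b)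
      case True
      then have "braid_img a i = [(i, False), (Suc i, False), (i, True)]" "braid_img (flip a) i = [(Suc i, False)]"
        by (simp_all add: a braid_img_def)
      then show ?thesis by (simp add: 1 mi mSi act fp fp_last)
    next
      case False
      then have "braid_img a i = [(Suc i, False)]" "braid_img (flip a) i = [(i, False), (Suc i, False), (i, True)]"
        by (simp_all add: a braid_img_def)
      then show ?thesis by (simp add: 1 mi mSi act fp fp_last)
    qed
  next
    case 2
    show ?thesis
    proof (cases b)
      case True
      then have "braid_img a i = [(i, False), (Suc i, False), (i, True)]" "braid_img a (Suc i) = [(i, False)]"
        "braid_img (flip a) (Suc i) = [(Suc i, True), (i, False), (Suc i, False)]"
        by (simp_all add: a braid_img_def)
      then show ?thesis by (simp add: 2 mi mSi act fp fp_last)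
    next
      case False
      then have "braid_img a i = [(Suc i, False)]" "braid_img a (Suc i) = [(Suc i, True), (i, False), (Suc i, False)]"
        "braid_img (flip a) (Suc i) = [(i, False)]"
        by (simp_all add: a braid_img_def)
      then show ?thesis by (simp add: 2 mi mSi act fp fp_last)
    qed
  qed
qed

abbreviation mirror :: "nat \<Rightarrow> word \<Rightarrow> word" where
  "mirror n \<equiv> ext_hom n mirror_img"

lemma mirror_funcset: "mirror n \<in> F n \<rightarrow> F n"
  using ext_hom_in_F[of n mirror_img] mirror_img_words by blast

lemma comp_mirror_mirror: "comp_aut n (mirror n) (mirror n) = id_aut n"
  unfolding id_aut_ext_hom
  by (subst comp_ext_hom) (auto intro!: ext_hom_cong mirror_img_words simp: mirror_mirror)

lemma mirror_braid_img:
  assumes "1 \<le> fst a" "fst a \<le> n - 1"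
  shows "comp_aut n (mirror n) (ext_hom n (braid_img a)) = comp_aut n (ext_hom n (braid_img (flip a))) (mirror n)"
  using assms
  by (subst (1 2) comp_ext_hom)
    (auto intro!: ext_hom_cong mirror_img_words braid_img_words mirror_conjugates_braid_img)

lemma mirror_aut_prod:
  assumes "ws \<in> braid_words n"
  shows "comp_aut n (mirror n) (aut_prod n ws) = comp_aut n (aut_prod n (map flip ws)) (mirror n)"
  using assms
proof (induction ws)
  case Nil
  then show ?case by (simp add: comp_id_left comp_id_right mirror_funcset)
next
  case (Cons a ws)
  then have a: "1 \<le> fst a" "fst a \<le> n - 1" "1 \<le> fst (flip a)" "fst (flip a) \<le> n - 1" and ws: "ws \<in> braid_words n" by auto
  have "comp_aut n (mirror n) (aut_prod n (a # ws))
      = comp_aut n (comp_aut n (mirror n) (ext_hom n (braid_img a))) (aut_prod n ws)"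
    by (simp only: aut_prod_Cons[OF a(1,2)] comp_aut_assoc[OF mirror_funcset])
  also have "\<dots> = comp_aut n (ext_hom n (braid_img (flip a))) (comp_aut n (mirror n) (aut_prod n ws))"
    by (simp only: mirror_braid_img[OF a(1,2)] comp_aut_assoc[OF braid_img_funcset[OF a(3,4)]])
  also have "\<dots> = comp_aut n (aut_prod n (map flip (a # ws))) (mirror n)"
    by (simp only: Cons.IH[OF ws] list.map aut_prod_Cons[OF a(3,4)] comp_aut_assoc[OF braid_img_funcset[OF a(3,4)]])
  finally show ?case .
qed

section \<open>The trichotomy\<close>

lemma is_aut_apply:
  assumes aut: "is_aut n f" and w: "w \<in> F n"
  shows "f w = reduce (subst (\<lambda>i. f (gen i)) w)"
proof -
  have hom: "f (reduce (u @ v)) = reduce (f u @ f v)" if "u \<in> F n" "v \<in> F n" for u v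
    using aut that by (simp add: is_aut_def fmul_def)
  have fF: "f u \<in> F n" if "u \<in> F n" for u
    using aut that by (auto simp: is_aut_def bij_betw_def)
  have NilF: "[] \<in> F n" by (simp add: F_iff)
  have red: "reduce (f u) = f u" if "u \<in> F n" for u using fF[OF that] by (simp add: F_iff)
  have "reduce (f [] @ f []) = reduce (f [] @ [])" using hom[OF NilF NilF] red[OF NilF] by simp
  then have f_Nil: "f [] = []" using red[OF NilF] by (simp only: reduce_eq_left_cancel) simp
  have f_inv: "f (finv u) = finv (f u)" if u: "u \<in> F n" for u
  proof -
    have iu: "finv u \<in> F n" using u by (simp add: F_iff)
    have "reduce (f u @ f (finv u)) = reduce (f u @ finv (f u))"
      using hom[OF u iu] f_Nil by simp
    then have "reduce (f (finv u)) = reduce (finv (f u))" by (simp only: reduce_eq_left_cancel)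
    then show ?thesis using red[OF iu] red[OF u] by (simp add: reduce_finv)
  qed
  show ?thesis using w
  proof (induction w)
    case Nil
    then show ?case by (simp add: f_Nil)
  next
    case (Cons a w)
    then have wF: "w \<in> F n" and aF: "[a] \<in> F n" and ra: "reduced (a # w)" and gF: "gen (fst a) \<in> F n"
      by (auto simp: F_iff reduced_Cons)
    have "[a] = (if snd a then finv (gen (fst a)) else gen (fst a))"
      by (cases a) (auto simp: gen_def)
    then have fa: "f [a] = subst (\<lambda>i. f (gen i)) [a]" using f_inv[OF gF] by auto
    have "f (a # w) = reduce (f [a] @ f w)" using hom[OF aF wF] ra by simp
    also have "\<dots> = reduce (subst (\<lambda>i. f (gen i)) [a] @ subst (\<lambda>i. f (gen i)) w)"
      using Cons.IH[OF wF] fa by (simp only: reduce_append_reduce_right)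
    finally show ?case by simp
  qed
qed

lemma subst_positive: "subst g (map (\<lambda>i. (i, False)) l) = concat (map g l)"
  by (induction l) auto

text \<open>Since z_1 is the inverse of t_1...t_n, fixing it fixes the full product; permuting the
  classes makes every image a conjugate of a generator, to which
  \<open>conj_word_normal_form\<close> applies.\<close>

lemma B_braid_tuple:
  assumes "\<phi> \<in> B n"
  shows "\<phi> = ext_hom n (\<lambda>i. \<phi> (gen i))" "braid_tuple n (\<lambda>i. \<phi> (gen i))"
proof -
  let ?g = "\<lambda>i. \<phi> (gen i)"
  from assms have aut: "is_aut n \<phi>" and z: "\<phi> (z1 n) = z1 n"
    and perm: "(\<lambda>C. \<phi> ` C) ` ((\<lambda>i. conj_class n (gen i)) ` {1..n}) = (\<lambda>i. conj_class n (gen i)) ` {1..n}"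
    by (auto simp: B_def bij_betw_def)
  show "\<phi> = ext_hom n ?g"
    using aut by (intro extensionalityI[where A = "F n"]) (auto simp: is_aut_def ext_hom_apply is_aut_apply[OF aut, symmetric])
  let ?T = "full_product n"
  have T: "reduced ?T" by (rule reduced_positive) auto
  have TF: "?T \<in> F n" using T by (auto simp: F_iff words_def)
  have "finv ?T \<in> F n" using TF by (simp add: F_iff del: upt_Suc)
  from is_aut_apply[OF aut this] z have "finv ?T = reduce (subst ?g (finv ?T))"
    unfolding z1_def by (rule back_subst[of "\<lambda>x. x = _"])
  also have "\<dots> = finv (reduce (subst ?g ?T))" by (simp add: reduce_finv del: upt_Suc)
  finally have "reduce (subst ?g ?T) = ?T" by (metis finv_finv)
  then have prod: "reduce (concat (map ?g [1..<Suc n])) = ?T" by (simp only: subst_positive)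
  have "?g i \<in> F n \<and> (\<exists>P c. ?g i = conj_word P c)" if i: "i \<in> {1..n}" for i
  proof -
    have "gen i \<in> conj_class n (gen i)"
      using i by (auto simp: conj_class_def conjugate_def F_iff fmul_def intro!: bexI[of _ "[]"])
    moreover obtain m where "\<phi> ` conj_class n (gen i) = conj_class n (gen m)"
      using perm i by (metis (no_types, lifting) imageE imageI)
    ultimately have "?g i \<in> conj_class n (gen m)" by blast
    then obtain h where F: "?g i \<in> F n" and h: "?g i = reduce (finv h @ gen m @ h)"
      by (auto simp: conj_class_def conjugate_def fmul_def)
    have "\<exists>P. ?g i = conj_word P m"
      using conj_word_normal_form[of "finv h" m] h by (simp add: gen_def)
    with F show ?thesis by blast
  qed
  with prod show "braid_tuple n ?g" by (auto simp: braid_tuple_def simp del: upt_Suc)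
qed

lemma reduce_concat_reduce: "reduce (concat (map (\<lambda>k. reduce (f k)) l)) = reduce (concat (map f l))"
proof (induction l)
  case (Cons a l)
  from reduce_append_cong[OF _ this, of "reduce (f a)" "f a"] show ?case by simp
qed simp

text \<open>The tuple of the automorphism conjugated by the mirror. The full product is inverted,
  fixed and inverted back; likewise each generator is inverted twice, so its image is again a
  conjugate of a generator and not of an inverse.\<close>

lemma braid_tuple_mirror:
  assumes tup: "braid_tuple n g"
  shows "braid_tuple n (\<lambda>k. reduce (subst mirror_img (subst g (mirror_img k))))"
proof -
  let ?f = "\<lambda>k. subst mirror_img (subst g (mirror_img k))"
  let ?T = "full_product n"
  have gw: "g k \<in> words n" if "1 \<le> k" "k \<le> n" for k
    using tup that by (auto simp: braid_tuple_def F_iff)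
  have redT: "reduced ?T" by (rule reduced_positive) auto
  have gT: "reduce (subst g ?T) = reduce ?T"
    using tup redT by (simp add: braid_tuple_def subst_positive del: upt_Suc)
  have mT: "reduce (subst mirror_img ?T) = reduce (finv ?T)" by (rule mirror_seg)
  have "reduce (concat (map (\<lambda>k. reduce (?f k)) [1..<Suc n])) = reduce (subst ?f ?T)"
    by (simp only: reduce_concat_reduce subst_positive)
  also have "\<dots> = reduce (subst mirror_img (subst g (subst mirror_img ?T)))"
    by (simp only: subst_subst)
  also have "\<dots> = reduce (subst mirror_img (subst g (finv ?T)))"
    by (intro reduce_subst_arg_cong mT)
  also have "\<dots> = reduce (subst mirror_img (finv ?T))"
    using gT by (intro reduce_subst_arg_cong) (simp add: reduce_finv del: upt_Suc)
  also have "\<dots> = finv (reduce (finv ?T))"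
    by (simp only: subst_finv reduce_finv[of "subst mirror_img ?T"] mT)
  also have "\<dots> = ?T"
    using redT by (simp add: reduce_finv del: upt_Suc)
  finally have prod: "reduce (concat (map (\<lambda>k. reduce (?f k)) [1..<Suc n])) = ?T" .
  have "reduce (?f k) \<in> F n \<and> (\<exists>P c. reduce (?f k) = conj_word P c)" if k: "1 \<le> k" "k \<le> n" for k
  proof
    show "reduce (?f k) \<in> F n"
      by (intro reduce_in_F subst_words[OF mirror_img_words] subst_words[OF gw] mirror_img_words k)
    have "\<exists>P c. g k = conj_word P c" using tup k by (simp add: braid_tuple_def del: upt_Suc)
    then obtain P c where gk: "g k = conj_word P c" by blast
    let ?U = "subst mirror_img (subst g (seg 1 k) @ P)"
    have "?f k = conj_word (?U @ seg 1 c) c"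
      by (simp add: subst_mirror_img[of g] gk) (simp add: mirror_img_def)
    then show "\<exists>P c. reduce (?f k) = conj_word P c" using conj_word_normal_form by metis
  qed
  with prod show ?thesis by (auto simp: braid_tuple_def simp del: upt_Suc)
qed

lemma B_nonpos_or_nonneg:
  assumes n: "1 \<le> n" and phi: "\<phi> \<in> B n"
  shows "\<exists>ws\<in>nonpos_words n. \<phi> = aut_prod n ws \<or> \<phi> = aut_prod n (map flip ws)"
proof -
  define g where "g i = \<phi> (gen i)" for i
  from B_braid_tuple[OF phi] have eq: "\<phi> = ext_hom n g" and tup: "braid_tuple n g"
    by (simp_all add: g_def[abs_def])
  have gF: "g k \<in> F n" "g k \<in> words n" if "1 \<le> k" "k \<le> n" for k
    using tup that by (auto simp: braid_tuple_def F_iff)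
  have phiF: "\<phi> \<in> F n \<rightarrow> F n" and phiE: "\<phi> \<in> extensional (F n)"
    using eq ext_hom_in_F[of n g] gF by auto
  have "\<exists>P c. g 1 = conj_word P c" using tup n by (simp add: braid_tuple_def del: upt_Suc)
  then obtain P c where g1: "g 1 = conj_word P c" by blast
  show ?thesis
  proof (cases "\<exists>w. g 1 = (1, False) # w")
    case True
    with braid_tuple_nonpos[OF n tup] eq show ?thesis by blast
  next
    case False
    let ?h = "\<lambda>k. reduce (subst mirror_img (subst g (mirror_img k)))"
    have "?h 1 = reduce (subst mirror_img (finv (g 1)))" by (simp add: mirror_img_def)
    moreover have "finv (g 1) \<noteq> []" unfolding g1 by simp
    \<comment> \<open>A conjugate P c P^-1 and its inverse share their first letter unless
      \<open>P\<close> is empty, and then the inverse starts with an inverse letter.\<close>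
    moreover have "hd (finv (g 1)) \<noteq> (1, False)"
      using False unfolding g1 by (cases P) auto
    ultimately obtain w where "?h 1 = (1, False) # w"
      using mirror_starts_with_gen1[of "finv (g 1)" n] gF[of 1] n by (auto simp: F_iff)
    from braid_tuple_nonpos[OF n braid_tuple_mirror[OF tup] this] obtain ws where
      ws: "ws \<in> nonpos_words n" and h: "ext_hom n ?h = aut_prod n ws" by blast
    then have bws: "ws \<in> braid_words n" by (simp add: nonpos_words_def)
    let ?m = "mirror n"
    have "comp_aut n (comp_aut n ?m \<phi>) ?m = ext_hom n (\<lambda>k. subst mirror_img (subst g (mirror_img k)))"
      unfolding eq using gF mirror_img_words
      by (simp add: comp_ext_hom subst_words)
    also have "\<dots> = ext_hom n ?h" by (rule ext_hom_cong) simp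
    finally have "comp_aut n ?m (comp_aut n \<phi> ?m) = aut_prod n ws"
      using h by (simp add: comp_aut_assoc mirror_funcset)
    \<comment> \<open>Undoing the mirror: moving it past \<open>ws\<close> flips every braid letter,
      and then it cancels on the right.\<close>
    then have "comp_aut n ?m (aut_prod n ws) = comp_aut n (comp_aut n ?m ?m) (comp_aut n \<phi> ?m)"
      by (simp only: comp_aut_assoc[OF mirror_funcset])
    then have "comp_aut n (aut_prod n (map flip ws)) ?m = comp_aut n \<phi> ?m"
      using bws by (simp add: comp_mirror_mirror comp_id_left mirror_aut_prod)
    then have "comp_aut n (comp_aut n (aut_prod n (map flip ws)) ?m) ?m = comp_aut n (comp_aut n \<phi> ?m) ?m"
      by (rule arg_cong)
    then have "aut_prod n (map flip ws) = \<phi>"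
      using bws phiF phiE by (simp add: comp_aut_assoc aut_prod_funcset comp_mirror_mirror comp_id_right)
    with ws show ?thesis by blast
  qed
qed

lemma inv_aut_inv_aut:
  assumes "is_aut n f"
  shows "inv_aut n (inv_aut n f) = f"
proof (rule inv_aut_unique)
  have bij: "bij_betw f (F n) (F n)" and ext: "f \<in> extensional (F n)" using assms by (auto simp: is_aut_def)
  show "inv_aut n f \<in> F n \<rightarrow> F n"
    using bij bij_betw_inv_into[OF bij] by (auto simp: inv_aut_def bij_betw_def)
  show "f \<in> F n \<rightarrow> F n" using bij by (auto simp: bij_betw_def)
  show "f \<in> extensional (F n)" by (fact ext)
  show "comp_aut n (inv_aut n f) f = id_aut n"
    using bij by (auto simp: comp_aut_def id_aut_def inv_aut_def fun_eq_iff bij_betw_inv_into_right)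
  show "comp_aut n f (inv_aut n f) = id_aut n"
    using bij by (auto simp: comp_aut_def id_aut_def inv_aut_def fun_eq_iff bij_betw_inv_into_left bij_betwE)
qed

lemma finv_positive_nonpos:
  assumes "\<forall>a\<in>set ws. 1 \<le> fst a \<and> fst a \<le> n - 1 \<and> (snd a \<longrightarrow> 2 \<le> fst a)" "(1, False) \<in> set ws"
  shows "ws \<in> braid_words n" "finv ws \<in> nonpos_words n" "(1, True) \<in> set (finv ws)"
proof -
  show bws: "ws \<in> braid_words n" using assms(1) by (simp add: braid_words_def)
  have "(1, True) \<notin> set ws" using assms(1) by fastforce
  then have "(1, False) \<notin> set (finv ws)" by (auto simp: finv_def flip_def)
  with bws show "finv ws \<in> nonpos_words n" by (simp add: nonpos_words_def)
  show "(1, True) \<in> set (finv ws)" using assms(2) by (force simp: finv_def flip_def)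
qed

lemma B_trichotomy:
  assumes n: "1 \<le> n" and phi: "\<phi> \<in> B n"
  shows "sigma1_neutral n \<phi> \<or> sigma1_negative n \<phi> \<or> sigma1_positive n \<phi>"
proof -
  from B_nonpos_or_nonneg[OF assms] obtain ws where ws: "ws \<in> nonpos_words n"
    and eq: "\<phi> = aut_prod n ws \<or> \<phi> = aut_prod n (map flip ws)" by blast
  have range: "1 \<le> fst a" "fst a \<le> n - 1" "a \<noteq> (1, False)" if "a \<in> set ws" for a
    using ws that by (auto simp: nonpos_words_def braid_words_def)
  show ?thesis
  proof (cases "(1, True) \<in> set ws")
    case False
    have "2 \<le> fst a" if "a \<in> set ws" for a
    proof -
      have "a \<noteq> (1, True)" using False that by auto
      then show ?thesis using range[OF that] by (cases a; cases "snd a") auto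
    qed
    then have "\<forall>a\<in>set ws. 2 \<le> fst a \<and> fst a \<le> n - 1" "\<forall>a\<in>set (map flip ws). 2 \<le> fst a \<and> fst a \<le> n - 1"
      using range by auto
    with eq show ?thesis unfolding sigma1_neutral_def by blast
  next
    case True
    have n2: "2 \<le> n" using range(1,2)[OF True] by simp
    have pos: "\<forall>a\<in>set (map flip ws). 1 \<le> fst a \<and> fst a \<le> n - 1 \<and> (snd a \<longrightarrow> 2 \<le> fst a)"
    proof
      fix a assume "a \<in> set (map flip ws)"
      then obtain b where b: "b \<in> set ws" "a = flip b" by auto
      then show "1 \<le> fst a \<and> fst a \<le> n - 1 \<and> (snd a \<longrightarrow> 2 \<le> fst a)"
        using range[OF b(1)] by (cases b rule: prod.exhaust) (auto simp: b(2))
    qed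
    have mem: "(1, False) \<in> set (map flip ws)" using True by (force simp: flip_def)
    from eq show ?thesis
    proof
      assume "\<phi> = aut_prod n (map flip ws)"
      with n2 pos mem have "sigma1_positive n \<phi>" unfolding sigma1_positive_def by blast
      then show ?thesis by blast
    next
      assume "\<phi> = aut_prod n ws"
      then have "inv_aut n \<phi> = aut_prod n (rev (map flip ws))"
        using inv_aut_prod[of ws n] ws by (simp add: nonpos_words_def finv_def)
      \<comment> \<open>Reversal keeps the set of letters, so \<open>pos\<close> and
        \<open>mem\<close> also serve the negative case.\<close>
      moreover have "set (rev (map flip ws)) = set (map flip ws)" by simp
      ultimately have "sigma1_negative n \<phi>"
        unfolding sigma1_negative_def sigma1_positive_def using n2 pos mem by metis
      then show ?thesis by blast
    qed
  qed
qed

section \<open>Reading off the conditions from a braid word\<close>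

lemma neutral_consequences:
  assumes "1 \<le> n" "sigma1_neutral n \<phi>"
  shows "\<phi> (gen 1) = gen 1" "\<phi> ` star n (gen 1) = star n (gen 1)"
  using assms neutral_fixes_gen1 neutral_star unfolding sigma1_neutral_def by blast+

text \<open>Strictness of the inclusion is witnessed by t_1, which no element of the star is mapped
  to.\<close>

lemma negative_consequences:
  assumes n: "1 \<le> n" and phi: "\<phi> \<in> B n" and neg: "sigma1_negative n \<phi>"
  shows "\<phi> (gen 1) \<in> star n (gen 1) - {gen 1}" "\<phi> ` star n (gen 1) \<subset> star n (gen 1)"
proof -
  from neg obtain ws where ws: "\<forall>a\<in>set ws. 1 \<le> fst a \<and> fst a \<le> n - 1 \<and> (snd a \<longrightarrow> 2 \<le> fst a)"
    "(1, False) \<in> set ws" and eq: "inv_aut n \<phi> = aut_prod n ws"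
    by (auto simp: sigma1_negative_def sigma1_positive_def)
  note ws' = finv_positive_nonpos[OF ws]
  have "\<phi> = aut_prod n (finv ws)"
    using inv_aut_inv_aut[of n \<phi>] phi inv_aut_prod[OF ws'(1)] eq by (simp add: B_def)
  with nonpos_word_star[OF ws'(2)] ws'(3)
  have maps: "\<phi> w \<in> star n (gen 1) - {gen 1}" if "w \<in> star n (gen 1)" for w using that by blast
  have gen: "gen 1 \<in> star n (gen 1)" using n by (simp add: star_def F_iff)
  show "\<phi> (gen 1) \<in> star n (gen 1) - {gen 1}" by (rule maps[OF gen])
  have "gen 1 \<notin> \<phi> ` star n (gen 1)" using maps by (metis Diff_iff imageE singletonI)
  with maps gen show "\<phi> ` star n (gen 1) \<subset> star n (gen 1)" by blast
qed

text \<open>The inverse of \<open>\<phi>\<close> maps the star into itself and misses t_1. Hence the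
  image of t_1 under \<open>\<phi>\<close> lies outside the star, and it witnesses
  strictness.\<close>

lemma positive_consequences:
  assumes n: "1 \<le> n" and pos: "sigma1_positive n \<phi>"
  shows "\<phi> (gen 1) \<notin> star n (gen 1)" "\<phi> ` star n (gen 1) \<supset> star n (gen 1)"
proof -
  from pos obtain ws where ws: "\<forall>a\<in>set ws. 1 \<le> fst a \<and> fst a \<le> n - 1 \<and> (snd a \<longrightarrow> 2 \<le> fst a)"
    "(1, False) \<in> set ws" and eq: "\<phi> = aut_prod n ws"
    by (auto simp: sigma1_positive_def)
  note ws' = finv_positive_nonpos[OF ws]
  let ?psi = "aut_prod n (finv ws)"
  from nonpos_word_star[OF ws'(2)] ws'(3)
  have maps: "?psi w \<in> star n (gen 1) - {gen 1}" if "w \<in> star n (gen 1)" for w using that by blast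
  have starF: "w \<in> F n" if "w \<in> star n (gen 1)" for w using that by (simp add: star_def)
  have inv: "\<phi> (?psi w) = w" "?psi (\<phi> w) = w" if "w \<in> F n" for w
    using aut_prod_inverse_apply[of ws n w] aut_prod_inverse_apply[of "finv ws" n w] ws'(1) that eq by auto
  have gen: "gen 1 \<in> star n (gen 1)" using n by (simp add: star_def F_iff)
  show a3: "\<phi> (gen 1) \<notin> star n (gen 1)"
    using maps[of "\<phi> (gen 1)"] inv(2)[OF starF[OF gen]] by auto
  have "w \<in> \<phi> ` star n (gen 1)" if "w \<in> star n (gen 1)" for w
    using maps[OF that] inv(1)[OF starF[OF that]] by (metis Diff_iff imageI)
  with a3 gen show "\<phi> ` star n (gen 1) \<supset> star n (gen 1)" by blast
qed

theorem theorem6p6: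
  fixes n :: nat and \<phi> :: "word \<Rightarrow> word"
  assumes "1 \<le> n" and "\<phi> \<in> B n"
  defines "a1 \<equiv> \<phi> (gen 1) = gen 1"
    and "a2 \<equiv> \<phi> (gen 1) \<in> star n (gen 1) - {gen 1}"
    and "a3 \<equiv> \<phi> (gen 1) \<notin> star n (gen 1)"
    and "b1 \<equiv> sigma1_neutral n \<phi>"
    and "b2 \<equiv> sigma1_negative n \<phi>"
    and "b3 \<equiv> sigma1_positive n \<phi>"
    and "c1 \<equiv> \<phi> ` star n (gen 1) = star n (gen 1)"
    and "c2 \<equiv> \<phi> ` star n (gen 1) \<subset> star n (gen 1)"
    and "c3 \<equiv> \<phi> ` star n (gen 1) \<supset> star n (gen 1)"
  shows "(a1 \<longleftrightarrow> b1) \<and> (b1 \<longleftrightarrow> c1)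
       \<and> (a2 \<longleftrightarrow> b2) \<and> (b2 \<longleftrightarrow> c2)
       \<and> (a3 \<longleftrightarrow> b3) \<and> (b3 \<longleftrightarrow> c3)
       \<and> ((b1 \<and> \<not> b2 \<and> \<not> b3) \<or> (\<not> b1 \<and> b2 \<and> \<not> b3) \<or> (\<not> b1 \<and> \<not> b2 \<and> b3))"
proof -
  have b: "b1 \<or> b2 \<or> b3"
    unfolding b1_def b2_def b3_def by (rule B_trichotomy[OF assms(1,2)])
  have imp1: "a1 \<and> c1" if b1
    using neutral_consequences[OF assms(1)] that unfolding a1_def b1_def c1_def by simp
  have imp2: "a2 \<and> c2" if b2
    using negative_consequences[OF assms(1,2)] that unfolding a2_def b2_def c2_def by simp
  have imp3: "a3 \<and> c3" if b3
    using positive_consequences[OF assms(1)] that unfolding a3_def b3_def c3_def by simp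
  have "gen 1 \<in> star n (gen 1)" using assms(1) by (simp add: star_def F_iff)
  then have a: "\<not> (a1 \<and> a2)" "\<not> (a1 \<and> a3)" "\<not> (a2 \<and> a3)"
    unfolding a1_def a2_def a3_def by auto
  have c: "\<not> (c1 \<and> c2)" "\<not> (c1 \<and> c3)" "\<not> (c2 \<and> c3)"
    unfolding c1_def c2_def c3_def by auto
  \<comment> \<open>The three (b) conditions are exhaustive, while the (a) conditions and the (c)
    conditions are each pairwise exclusive, so the one-way implications reverse.\<close>
  from b imp1 imp2 imp3 a c show ?thesis by blast
qed

end
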